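(* Let $N$ be a real skew-symmetric $n\times n$ matrix, let $k=\lfloor n/2\rfloor$, and let $\tilde\lambda(N)=(\tilde\lambda_1\ge\cdots\ge\tilde\lambda_k)$. Let $\mathcal{O}_N=\mathrm{conv}\{gNg^T : g\in O(n)\}$. Then $$\mathcal{O}_N=\Bigl\{A\in\wedge_2\mathbb{R}^n\;:\; 2(\tilde\lambda_1+\cdots+\tilde\lambda_j)\,\mathrm{Id}_{\binom{2n}{2j}}-\mathcal{L}_{2j}(\hat A)\succeq0\ \text{ for } j=1,\dots,k\Bigr\}.$$
   Context: $\wedge_2\mathbb{R}^n$ is identified with the space of real skew-symmetric $n\times n$ matrices. $\mathrm{conv}$ denotes convex hull and $\succeq 0$ positive semidefiniteness. $\mathcal{O}_N$ is called the skew-symmetric Schur-Horn orbitope of $N$. The eigenvalues of $N$ are purely imaginary, $\pm i\tilde\lambda_1,\dots,\pm i\tilde\lambda_k$ with $k=\lfloor n/2\rfloor$ and $\tilde\lambda_1\ge\cdots\ge\tilde\lambda_k\ge0$, together with an additional eigenvalue $0$ if $n$ is odd; write $\tilde\lambda(N)=(\tilde\lambda_1,\dots,\tilde\lambda_k)$. For skew-symmetric $A$, $\hat A$ is the symmetric $2n\times2n$ matrix $\hat A=\begin{pmatrix}0&A\\-A&0\end{pmatrix}$. For an $m\times m$ matrix $B$, the $r$-th additive compound matrix $\mathcal{L}_r(B)$ is the $\binom mr\times\binom mr$ matrix representing, in the standard basis of $\wedge_r\mathbb{R}^m$, the linear map $$v_{1}\wedge\cdots\wedge v_{r}\mapsto\sum_{j=1}^r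 v_{1}\wedge\cdots\wedge v_{j-1}\wedge(Bv_{j})\wedge v_{j+1}\wedge\cdots\wedge v_{r}.$$ *)

theory Defs
  imports
    "Jordan_Normal_Form.Char_Poly"
    "HOL-Computational_Algebra.Fundamental_Theorem_Algebra"
begin

subsection \<open>Skew-symmetric and orthogonal matrices, convex hulls\<close>

definition skew_mats :: "nat \<Rightarrow> real mat set" where
  "skew_mats n = {A \<in> carrier_mat n n. transpose_mat A = - A}"

text \<open>The library constant \<open>orthogonal_mat\<close> only asks for pairwise orthogonal columns, not for
  orthonormal ones, so it does not describe the group \<open>O(n)\<close>.\<close>

definition orthogonal_group :: "nat \<Rightarrow> real mat set" where
  "orthogonal_group n =
     {g \<in> carrier_mat n n. transpose_mat g * g = 1\<^sub>m n \<and> g * transpose_mat g = 1\<^sub>m n}"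

text \<open>The type of matrices of arbitrary dimension is not a vector space, so the library's
  \<open>convex\<close> does not apply to it; this is the same definition with the matrix operations.\<close>

definition mat_convex :: "real mat set \<Rightarrow> bool" where
  "mat_convex S \<longleftrightarrow>
     (\<forall>X\<in>S. \<forall>Y\<in>S. \<forall>u\<ge>0. \<forall>v\<ge>0. u + v = 1 \<longrightarrow> u \<cdot>\<^sub>m X + v \<cdot>\<^sub>m Y \<in> S)"

definition skew_orbitope :: "nat \<Rightarrow> real mat \<Rightarrow> real mat set" where
  "skew_orbitope n N = mat_convex hull ((\<lambda>g. g * N * transpose_mat g) ` orthogonal_group n)"

definition psd_mat :: "real mat \<Rightarrow> bool" where
  "psd_mat M \<longleftrightarrow> square_mat M \<and> transpose_mat M = M \<and>
     (\<forall>v \<in> carrier_vec (dim_row M). 0 \<le> v \<bullet> (M *\<^sub>v v))"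

definition skew_hat :: "real mat \<Rightarrow> real mat" where
  "skew_hat A = four_block_mat
     (0\<^sub>m (dim_row A) (dim_col A)) A
     (- A) (0\<^sub>m (dim_row A) (dim_col A))"


subsection \<open>The spectrum of a skew-symmetric matrix\<close>

text \<open>\<open>is_skew_spectrum N l\<close>: the list \<open>l\<close> is weakly decreasing, nonnegative, of length
  \<open>\<lfloor>n/2\<rfloor>\<close>, and the complex eigenvalues of \<open>N\<close>, counted with algebraic multiplicity, are the
  \<open>\<plusminus>\<i> l\<^sub>j\<close> together with an additional \<open>0\<close> if \<open>n\<close> is odd.\<close>

definition is_skew_spectrum :: "real mat \<Rightarrow> real list \<Rightarrow> bool" where
  "is_skew_spectrum N l \<longleftrightarrow>
     length l = dim_row N div 2 \<and> sorted_wrt (\<ge>) l \<and> (\<forall>x\<in>set l. 0 \<le> x) \<and>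
     proots (char_poly (map_mat complex_of_real N)) =
       mset (map (\<lambda>x. \<i> * complex_of_real x) l) + mset (map (\<lambda>x. - (\<i> * complex_of_real x)) l)
       + (if odd (dim_row N) then {#0#} else {#})"

definition skew_spectrum :: "real mat \<Rightarrow> real list" where
  "skew_spectrum N = (THE l. is_skew_spectrum N l)"

lemma is_skew_spectrum_unique:
  assumes "is_skew_spectrum N l" "is_skew_spectrum N l'"
  shows "l = l'"
proof -
  have key: "count (mset k) x =
      (if x < 0 then 0
       else if x = 0 then count (proots (char_poly (map_mat complex_of_real N))) 0 div 2
       else count (proots (char_poly (map_mat complex_of_real N))) (\<i> * complex_of_real x))"
    if k: "is_skew_spectrum N k" for k x
  proof -
    let ?p = "\<lambda>x. \<i> * complex_of_real x" and ?m = "\<lambda>x. - (\<i> * complex_of_real x)"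
    have cp: "count (mset (map ?p xs)) (?p x) = count (mset xs) x" for xs :: "real list"
      by (induction xs) auto
    have cm: "count (mset (map ?m xs)) (?p x) = 0" if "\<forall>y\<in>set xs. 0 \<le> y" "x > 0" for xs
    proof -
      have "?p x \<noteq> ?m y" if "y \<in> set xs" for y
        using that \<open>\<forall>y\<in>set xs. 0 \<le> y\<close> \<open>x > 0\<close> by (fastforce simp: complex_eq_iff)
      hence "?p x \<notin># mset (map ?m xs)" by auto
      thus ?thesis by (simp only: not_in_iff)
    qed
    have cm0: "count (mset (map ?m xs)) 0 = count (mset xs) 0" for xs :: "real list"
      by (induction xs) auto
    have cp0: "count (mset (map ?p xs)) 0 = count (mset xs) 0" for xs :: "real list"
      by (induction xs) auto
    consider "x < 0" | "x = 0" | "x > 0" by linarith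
    thus ?thesis
    proof cases
      case 1
      hence "x \<notin># mset k" using k by (fastforce simp: is_skew_spectrum_def)
      thus ?thesis using 1 by (simp add: not_in_iff)
    next
      case 2
      have "count (proots (char_poly (map_mat complex_of_real N))) 0 =
          2 * count (mset k) 0 + (if odd (dim_row N) then 1 else 0)"
        using k cp0[of k] cm0[of k] by (simp add: is_skew_spectrum_def del: mset_map count_proots)
      thus ?thesis using 2 by simp
    next
      case 3
      have "count (proots (char_poly (map_mat complex_of_real N))) (?p x) = count (mset k) x"
        using k cp[of k] cm[of k] 3 by (simp add: is_skew_spectrum_def del: mset_map count_proots)
      thus ?thesis using 3 by simp
    qed
  qed
  have "mset l = mset l'"
    by (rule multiset_eqI) (simp only: key[OF assms(1)] key[OF assms(2)])
  hence "mset (rev l) = mset (rev l')" by simp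
  moreover have "sorted (rev l)" "sorted (rev l')"
    using assms by (auto simp: is_skew_spectrum_def sorted_wrt_rev)
  ultimately have "rev l = rev l'" by (metis properties_for_sort)
  thus ?thesis by simp
qed

lemma skew_eigenvalue_imaginary:
  assumes N: "N \<in> skew_mats n"
    and z: "poly (char_poly (map_mat complex_of_real N)) z = 0"
  shows "Re z = 0"
proof -
  let ?C = "map_mat complex_of_real N"
  have Nc: "N \<in> carrier_mat n n" and Nt: "transpose_mat N = - N"
    using N by (auto simp: skew_mats_def)
  have C: "?C \<in> carrier_mat n n" using Nc by simp
  have anti: "N $$ (i, j) = - (N $$ (j, i))" if "i < n" "j < n" for i j
  proof -
    have "transpose_mat N $$ (j, i) = (- N) $$ (j, i)" using Nt by simp
    thus ?thesis using that Nc by simp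
  qed
  obtain v where v: "v \<in> carrier_vec n" "v \<noteq> 0\<^sub>v n" "?C *\<^sub>v v = z \<cdot>\<^sub>v v"
    using z C unfolding eigenvalue_root_char_poly[OF C, symmetric]
    by (auto simp: eigenvalue_def eigenvector_def)
  have row: "(\<Sum>j<n. complex_of_real (N $$ (i, j)) * v $ j) = z * v $ i" if "i < n" for i
  proof -
    have "(?C *\<^sub>v v) $ i = (z \<cdot>\<^sub>v v) $ i" using v(3) by simp
    thus ?thesis using that v(1) Nc by (simp add: scalar_prod_def atLeast0LessThan)
  qed
  define S where "S = (\<Sum>i<n. \<Sum>j<n. cnj (v $ i) * complex_of_real (N $$ (i, j)) * v $ j)"
  define T where "T = (\<Sum>i<n. (cmod (v $ i))\<^sup>2)"
  have S1: "S = z * complex_of_real T"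
  proof -
    have "S = (\<Sum>i<n. cnj (v $ i) * (z * v $ i))"
      unfolding S_def
      by (intro sum.cong refl) (simp add: row[symmetric] sum_distrib_left mult.assoc)
    also have "\<dots> = (\<Sum>i<n. z * complex_of_real ((cmod (v $ i))\<^sup>2))"
      by (intro sum.cong refl)
         (simp add: complex_norm_square mult.commute del: of_real_power)
    finally show ?thesis by (simp add: T_def sum_distrib_left)
  qed
  have "cnj S = (\<Sum>i<n. \<Sum>j<n. v $ i * complex_of_real (N $$ (i, j)) * cnj (v $ j))"
    by (simp add: S_def)
  also have "\<dots> = (\<Sum>j<n. \<Sum>i<n. v $ i * complex_of_real (N $$ (i, j)) * cnj (v $ j))"
    by (rule sum.swap)
  also have "\<dots> = - S"
    unfolding S_def sum_negf[symmetric]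
    by (intro sum.cong refl) (subst anti, auto)
  finally have "Re S = 0" by (auto simp: complex_eq_iff)
  hence "Re z * T = 0" by (simp add: S1)
  moreover have "T \<noteq> 0"
  proof
    assume "T = 0"
    hence "\<forall>i<n. v $ i = 0" unfolding T_def by (subst (asm) sum_nonneg_eq_0_iff) auto
    hence "v = 0\<^sub>v n" using v(1) by (intro eq_vecI) auto
    thus False using v(2) by simp
  qed
  ultimately show ?thesis by simp
qed

lemma order_cnj_real_poly:
  "order (cnj z) (map_poly complex_of_real q) = order z (map_poly complex_of_real q)"
    if "q \<noteq> 0"
proof -
  have le: "order z (map_poly complex_of_real q) \<le> order (cnj z) (map_poly complex_of_real q)" for z
  proof -
    let ?p = "map_poly complex_of_real q"
    have nz: "?p \<noteq> 0" using that by (simp add: poly_eq_iff coeff_map_poly)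
    have cc: "map_poly cnj ?p = ?p" by (simp add: poly_eq_iff coeff_map_poly)
    interpret cnj: comm_ring_hom cnj by unfold_locales auto
    interpret mp: map_poly_comm_ring_hom cnj ..
    have cnj_lin: "map_poly cnj [:- z, 1:] = [:- cnj z, 1:]" by simp
    obtain r where "?p = [:- z, 1:] ^ order z ?p * r" using order_1 by (rule dvdE)
    hence "map_poly cnj ?p = map_poly cnj [:- z, 1:] ^ order z ?p * map_poly cnj r"
      by (metis mp.hom_mult mp.hom_power)
    hence "[:- cnj z, 1:] ^ order z ?p dvd ?p" 
      by (metis cc dvd_triv_left cnj_lin)
    thus ?thesis using nz by (metis order_divides)
  qed
  show ?thesis using le[of z] le[of "cnj z"] by simp
qed

lemma is_skew_spectrum_skew_spectrum:
  assumes N: "N \<in> skew_mats n"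
  shows "is_skew_spectrum N (skew_spectrum N)"
proof -
  let ?C = "map_mat complex_of_real N"
  let ?p = "char_poly ?C"
  let ?P = "\<lambda>x. \<i> * complex_of_real x" and ?M = "\<lambda>x. - (\<i> * complex_of_real x)"
  have Nc: "N \<in> carrier_mat n n" using N by (auto simp: skew_mats_def)
  have C: "?C \<in> carrier_mat n n" using Nc by simp
  have nz: "?p \<noteq> 0" using degree_monic_char_poly[OF C] by auto
  have size: "size (proots ?p) = n" using degree_monic_char_poly[OF C] by (simp add: size_proots_complex)
  have real: "?p = map_poly complex_of_real (char_poly N)"
    by (rule of_real_hom.char_poly_hom[OF Nc])
  have nzr: "char_poly N \<noteq> 0" using degree_monic_char_poly[OF Nc] by auto
  have sym: "count (proots ?p) (cnj z) = count (proots ?p) z" for z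
    using order_cnj_real_poly[OF nzr] nz by (simp add: real)
  have im: "Re z = 0" if "z \<in># proots ?p" for z
    using that nz skew_eigenvalue_imaginary[OF N] by simp
  define Q where "Q = image_mset Im (filter_mset (\<lambda>z. Im z > 0) (proots ?p))"
  define c where "c = count (proots ?p) 0"
  define l where "l = rev (sorted_list_of_multiset (Q + replicate_mset (c div 2) 0))"
  have ml: "mset l = Q + replicate_mset (c div 2) 0" by (simp add: l_def)
  have count_inj: "count (image_mset f A) (f x) = count A x"
    if "inj f" for f :: "real \<Rightarrow> complex" and A x
    by (induction A) (use that in \<open>auto dest: injD\<close>)
  have inj: "inj ?P" "inj ?M" by (auto simp: inj_def)
  have cntQ: "count Q x = (if x > 0 then count (proots ?p) (?P x) else 0)" for x
  proof -
    have "image_mset ?P Q = image_mset (\<lambda>z. z) (filter_mset (\<lambda>z. Im z > 0) (proots ?p))"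
      unfolding Q_def multiset.map_comp comp_def
      by (rule image_mset_cong) (use im in \<open>auto simp: complex_eq_iff\<close>)
    hence eq: "image_mset ?P Q = filter_mset (\<lambda>z. Im z > 0) (proots ?p)" by simp
    have "count Q x = count (image_mset ?P Q) (?P x)"
      by (rule count_inj[OF inj(1), symmetric])
    thus ?thesis by (simp only: eq count_filter_mset) auto
  qed
  have cl: "count (mset l) x = (if x > 0 then count (proots ?p) (?P x)
      else if x = 0 then c div 2 else 0)" for x
    by (auto simp: ml cntQ)
  let ?R = "image_mset ?P (mset l) + image_mset ?M (mset l)"
  have eqR: "proots ?p = ?R + replicate_mset (c mod 2) 0"
  proof (rule multiset_eqI)
    fix z :: complex
    show "count (proots ?p) z = count (?R + replicate_mset (c mod 2) 0) z"
    proof (cases "Re z = 0")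
      case False
      hence "z \<notin># proots ?p" using im by auto
      moreover have "z \<notin># ?R + replicate_mset (c mod 2) 0" using False by (auto split: if_splits)
      ultimately show ?thesis by (metis not_in_iff)
    next
      case True
      define x where "x = Im z"
      have z: "z = ?P x" using True by (simp add: x_def complex_eq_iff)
      have z': "z = ?M (- x)" using z by simp
      have c1: "count (image_mset ?P (mset l)) z = count (mset l) x"
        unfolding z by (rule count_inj[OF inj(1)])
      have c2: "count (image_mset ?M (mset l)) z = count (mset l) (- x)"
        unfolding z' by (rule count_inj[OF inj(2)])
      have cj: "cnj z = ?P (- x)" by (simp add: z)
      consider "x > 0" | "x = 0" | "x < 0" by linarith
      thus ?thesis
      proof cases
        case 1
        hence "z \<noteq> 0" using z by auto
        thus ?thesis using 1 by (simp add: c1 c2 cl z[symmetric] del: count_proots)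
      next
        case 2
        hence "z = 0" using z by simp
        have "c = c div 2 + c div 2 + c mod 2" by presburger
        thus ?thesis using 2 \<open>z = 0\<close> by (simp add: c1[unfolded \<open>z = 0\<close>] c2[unfolded \<open>z = 0\<close>] cl c_def[symmetric] del: count_proots)
      next
        case 3
        hence "z \<noteq> 0" using z by auto
        thus ?thesis using 3 sym[of z] unfolding cj by (simp add: c1 c2 cl del: count_proots)
      qed
    qed
  qed
  have "n = 2 * length l + c mod 2"
    using arg_cong[OF eqR, of size] size by simp
  hence len: "length l = n div 2" and par: "odd n \<longleftrightarrow> c mod 2 = 1" by presburger+
  have "replicate_mset (c mod 2) (0::complex) = (if odd n then {#0#} else {#})"
    using par by (cases "c mod 2 = 1") auto
  hence "proots ?p = mset (map ?P l) + mset (map ?M l) + (if odd n then {#0#} else {#})"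
    using eqR by simp
  moreover have "sorted_wrt (\<ge>) l" by (simp add: l_def sorted_wrt_rev)
  moreover have "0 \<le> x" if "x \<in> set l" for x
  proof -
    have "count (mset l) x > 0" using that by simp
    thus ?thesis unfolding cl by (auto split: if_splits)
  qed
  ultimately have l: "is_skew_spectrum N l"
    using len Nc by (simp add: is_skew_spectrum_def)
  show ?thesis
    unfolding skew_spectrum_def by (rule theI[of "is_skew_spectrum N", OF l]) (rule is_skew_spectrum_unique[OF _ l])
qed


subsection \<open>Exterior powers and additive compound matrices\<close>

text \<open>The standard basis vectors \<open>e\<^sub>I\<close> of the \<open>r\<close>-th exterior power of \<open>\<real>\<^sup>m\<close> are indexed by the
  increasing \<open>r\<close>-tuples \<open>I\<close> in \<open>{0..<m}\<close>, listed lexicographically.\<close>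

definition wedge_index :: "nat \<Rightarrow> nat \<Rightarrow> nat list list" where
  "wedge_index m r = filter (\<lambda>I. length I = r) (subseqs [0..<m])"

lemma length_wedge_index: "length (wedge_index m r) = m choose r"
proof -
  have "length (filter (\<lambda>I. length I = r) (subseqs xs)) = length xs choose r" for xs :: "nat list"
  proof (induction xs arbitrary: r)
    case (Cons x xs)
    have "filter (\<lambda>I. I = []) (map ((#) x) ys) = []" for ys
      by (induction ys) auto
    thus ?case
      by (cases r) (use Cons[of 0] Cons in \<open>simp_all add: Let_def filter_map comp_def\<close>)
  qed (cases r; simp)
  thus ?thesis by (simp add: wedge_index_def)
qed

text \<open>Coordinates of \<open>v\<^sub>1 \<and> \<dots> \<and> v\<^sub>r\<close> in the standard basis: the coefficient of \<open>e\<^sub>I\<close> is the minor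
  with rows \<open>I\<close> of the matrix with columns \<open>v\<^sub>1, \<dots>, v\<^sub>r\<close>.\<close>

definition wedge :: "nat \<Rightarrow> real vec list \<Rightarrow> real vec" where
  "wedge m vs = (let r = length vs in
     vec (m choose r) (\<lambda>a. det (mat r r (\<lambda>(p, q). vs ! q $ (wedge_index m r ! a ! p)))))"

text \<open>The derivation \<open>v\<^sub>1 \<and> \<dots> \<and> v\<^sub>r \<mapsto> \<Sum>\<^sub>j v\<^sub>1 \<and> \<dots> \<and> B v\<^sub>j \<and> \<dots> \<and> v\<^sub>r\<close>, in coordinates.\<close>

definition wedge_derivation :: "real mat \<Rightarrow> real vec list \<Rightarrow> real vec" where
  "wedge_derivation B vs = (let m = dim_row B; r = length vs in
     vec (m choose r) (\<lambda>a. \<Sum>j<r. wedge m (vs[j := B *\<^sub>v (vs ! j)]) $ a))"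

text \<open>Its matrix: column \<open>b\<close> is the image of the \<open>b\<close>-th standard basis vector
  \<open>e\<^sub>I = e\<^bsub>I(1)\<^esub> \<and> \<dots> \<and> e\<^bsub>I(r)\<^esub>\<close>.\<close>

definition additive_compound :: "nat \<Rightarrow> real mat \<Rightarrow> real mat" where
  "additive_compound r B = (let m = dim_row B in
     mat_of_cols (m choose r)
       (map (\<lambda>I. wedge_derivation B (map (unit_vec m) I)) (wedge_index m r)))"

end

theory Submission
  imports Defs "Jordan_Normal_Form.Schur_Decomposition" "Jordan_Normal_Form.Spectral_Radius"
begin

text \<open>
Write \<open>\<lambda>\<close> and \<open>\<mu>\<close> for the decreasing spectra of \<open>N\<close> and \<open>A\<close>. Both sides of the theorem describe the set
of skew-symmetric \<open>A\<close> with \<open>\<mu>\<^sub>1 + \<dots> + \<mu>\<^sub>j \<le> \<lambda>\<^sub>1 + \<dots> + \<lambda>\<^sub>j\<close> for all \<open>j \<le> k\<close>, that is, with \<open>\<mu>\<close> weakly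
majorized by \<open>\<lambda>\<close>.

The link with the right-hand side is that the largest eigenvalue of the \<open>2j\<close>-th additive compound of
\<open>skew_hat A\<close> is the sum of the largest \<open>2j\<close> eigenvalues of \<open>skew_hat A\<close>. These eigenvalues are the numbers
\<open>\<plusminus> \<mu>\<^sub>t\<close>, each with multiplicity two, and possibly zeros, so the sum is
\<open>2 (\<mu>\<^sub>1 + \<dots> + \<mu>\<^sub>j)\<close>. The additive compound of
\<open>B\<close> is the operator \<open>\<Sum>\<^sub>i\<^sub>j B\<^sub>i\<^sub>j c\<^sub>i a\<^sub>j\<close> built from creation operators \<open>c\<^sub>i\<close> and annihilation operators \<open>a\<^sub>j\<close> on
the exterior algebra (\<open>psd_additive_compound_iff\<close>). For \<open>B = \<Sum> \<beta>\<^sub>l u\<^sub>l u\<^sub>l\<^sup>T\<close> with orthonormal \<open>u\<^sub>l\<close> it is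
\<open>\<Sum> \<beta>\<^sub>l c(u\<^sub>l) a(u\<^sub>l)\<close>, and the anticommutation relations show that the summands \<open>c(u\<^sub>l) a(u\<^sub>l)\<close> lie between
\<open>0\<close> and \<open>1\<close>. On the \<open>r\<close>-th exterior power their sum is at most \<open>r\<close>, which gives the upper bound
\<open>second_quantized_form_le\<close>; the wedge of the first \<open>r\<close> eigenvectors attains it
(\<open>second_quantized_form_slater\<close>).

For the inclusion from left to right it is then enough that the right-hand side is convex, which is clear since
the compound is linear in \<open>A\<close>, and that it contains the orbit, whose elements all have spectrum \<open>\<lambda>\<close>.

For the converse, the orthogonal normal form (\<open>skew_normal_form\<close>) reduces the problem to block diagonal matrices: the
set of vectors \<open>\<nu>\<close> whose block matrix lies in the orbitope is convex, contains \<open>\<lambda>\<close> and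
is invariant under permutations and sign changes, because these are realized by conjugation in \<open>O(n)\<close>. Such a set
contains every nonnegative decreasing vector that is weakly majorized by \<open>\<lambda>\<close>
(\<open>weak_majorization_closure\<close>).
\<close>

section \<open>Creation and annihilation operators\<close>

text \<open>A function \<open>f\<close> on finite sets of naturals stands for the vector \<open>\<Sum>\<^sub>S f S e\<^sub>S\<close> of the exterior
algebra, where \<open>e\<^sub>S\<close> is the wedge of the \<open>e\<^sub>i\<close>, \<open>i \<in> S\<close>, in increasing order. Moving \<open>e\<^sub>i\<close> from the
front of such a wedge to its sorted place costs one sign for every element below \<open>i\<close>.\<close>

definition fock_sign :: "nat \<Rightarrow> nat set \<Rightarrow> real" where
  "fock_sign i S = (-1) ^ card {s \<in> S. s < i}"

text \<open>Contraction with the \<open>i\<close>-th basis covector; \<open>create\<close> below is left multiplication by \<open>e\<^sub>i\<close>.\<close>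

definition annihilate :: "nat \<Rightarrow> (nat set \<Rightarrow> real) \<Rightarrow> nat set \<Rightarrow> real" where
  "annihilate i f = (\<lambda>S. if i \<in> S then 0 else fock_sign i S * f (insert i S))"

definition create :: "nat \<Rightarrow> (nat set \<Rightarrow> real) \<Rightarrow> nat set \<Rightarrow> real" where
  "create i f = (\<lambda>S. if i \<in> S then fock_sign i S * f (S - {i}) else 0)"

lemma fock_sign_square [simp]: "fock_sign i S * fock_sign i S = 1"
  by (simp add: fock_sign_def flip: power_mult_distrib)

lemma fock_sign_square_left [simp]: "fock_sign i S * (fock_sign i S * x) = x"
  by (metis fock_sign_square mult.assoc mult_1)

lemma fock_sign_insert:
  assumes "j \<notin> S"
  shows "fock_sign i (insert j S) = (if j < i then - fock_sign i S else fock_sign i S)"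
proof (cases "j < i")
  case True
  have "{s \<in> insert j S. s < i} = insert j {s \<in> S. s < i}" using True by auto
  thus ?thesis using True assms by (simp add: fock_sign_def)
next
  case False
  have "{s \<in> insert j S. s < i} = {s \<in> S. s < i}" using False by auto
  thus ?thesis using False by (simp add: fock_sign_def)
qed

lemma fock_sign_insert_self [simp]: "fock_sign i (insert i S) = fock_sign i S"
  unfolding fock_sign_def by (rule arg_cong[where f = "\<lambda>A. (-1) ^ card A"]) auto

lemma fock_sign_remove_self [simp]: "fock_sign i (S - {i}) = fock_sign i S"
  unfolding fock_sign_def by (rule arg_cong[where f = "\<lambda>A. (-1) ^ card A"]) auto

lemma fock_sign_remove:
  assumes "j \<in> S"
  shows "fock_sign i (S - {j}) = (if j < i then - fock_sign i S else fock_sign i S)"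
  using fock_sign_insert[of j "S - {j}" i] assms by (auto simp: insert_absorb split: if_splits)

lemma create_annihilate_same: "create i (annihilate i f) S = (if i \<in> S then f S else 0)"
  by (auto simp: create_def annihilate_def insert_absorb)

lemma annihilate_create_same: "annihilate i (create i f) S = (if i \<in> S then 0 else f S)"
  by (auto simp: create_def annihilate_def)

text \<open>The two orders of operation reach the same basis vector, but exactly one of the conditions
\<open>i < j\<close>, \<open>j < i\<close> holds, so exactly one of the two signs is affected by the other operator.\<close>

lemma annihilate_create_diff:
  assumes "i \<noteq> j"
  shows "annihilate i (create j f) S = - create j (annihilate i f) S"
proof (cases "i \<notin> S \<and> j \<in> S")
  case True
  have "insert i S - {j} = insert i (S - {j})" using assms by auto
  thus ?thesis using True assms
    by (auto simp: create_def annihilate_def fock_sign_insert fock_sign_remove)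
qed (use assms in \<open>auto simp: create_def annihilate_def\<close>)

lemma create_create: "create i (create j f) S = - create j (create i f) S"
proof (cases "i \<in> S \<and> j \<in> S \<and> i \<noteq> j")
  case True
  have "S - {i} - {j} = S - {j} - {i}" by auto
  thus ?thesis using True by (auto simp: create_def fock_sign_remove)
qed (auto simp: create_def)

definition annihilate_vec :: "nat \<Rightarrow> (nat \<Rightarrow> real) \<Rightarrow> (nat set \<Rightarrow> real) \<Rightarrow> nat set \<Rightarrow> real" where
  "annihilate_vec m u f = (\<lambda>S. \<Sum>i<m. u i * annihilate i f S)"

definition create_vec :: "nat \<Rightarrow> (nat \<Rightarrow> real) \<Rightarrow> (nat set \<Rightarrow> real) \<Rightarrow> nat set \<Rightarrow> real" where
  "create_vec m u f = (\<lambda>S. \<Sum>i<m. u i * create i f S)"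

lemma sum_rotate:
  "(\<Sum>i\<in>A. \<Sum>j\<in>B. \<Sum>l\<in>C. h i j l) = (\<Sum>l\<in>C. \<Sum>i\<in>A. \<Sum>j\<in>B. h i j l)"
proof -
  have "(\<Sum>i\<in>A. \<Sum>j\<in>B. \<Sum>l\<in>C. h i j l) = (\<Sum>i\<in>A. \<Sum>l\<in>C. \<Sum>j\<in>B. h i j l)"
    by (intro sum.cong refl sum.swap)
  also have "\<dots> = (\<Sum>l\<in>C. \<Sum>i\<in>A. \<Sum>j\<in>B. h i j l)" by (rule sum.swap)
  finally show ?thesis .
qed

lemma annihilate_sum:
  "annihilate i (\<lambda>S. \<Sum>j<m. v j * g j S) S = (\<Sum>j<m. v j * annihilate i (g j) S)"
  by (simp add: annihilate_def sum_distrib_left algebra_simps)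

lemma create_sum:
  "create i (\<lambda>S. \<Sum>j<m. v j * g j S) S = (\<Sum>j<m. v j * create i (g j) S)"
  by (simp add: create_def sum_distrib_left algebra_simps)

text \<open>The canonical anticommutation relation. It is bilinear in \<open>u\<close> and \<open>v\<close>, so it follows from the one
for basis vectors.\<close>

lemma anticommutator_annihilate_create:
  "annihilate_vec m u (create_vec m v f) S + create_vec m v (annihilate_vec m u f) S
     = (\<Sum>i<m. u i * v i) * f S"
proof -
  have "create_vec m v (annihilate_vec m u f) S
      = (\<Sum>j<m. \<Sum>i<m. v j * (u i * create j (annihilate i f) S))"
    by (simp add: create_vec_def annihilate_vec_def create_sum sum_distrib_left)
  also have "\<dots> = (\<Sum>i<m. \<Sum>j<m. u i * v j * create j (annihilate i f) S)"
    by (subst sum.swap) (simp add: mult_ac)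
  finally have "annihilate_vec m u (create_vec m v f) S + create_vec m v (annihilate_vec m u f) S
      = (\<Sum>i<m. \<Sum>j<m. u i * v j * (annihilate i (create j f) S + create j (annihilate i f) S))"
    by (simp add: create_vec_def annihilate_vec_def annihilate_sum sum_distrib_left sum.distrib
        algebra_simps)
  also have "\<dots> = (\<Sum>i<m. \<Sum>j<m. if j = i then u i * v i * f S else 0)"
    by (intro sum.cong refl)
       (auto simp: annihilate_create_diff create_annihilate_same annihilate_create_same)
  also have "\<dots> = (\<Sum>i<m. u i * v i) * f S"
    by (simp add: sum_distrib_right)
  finally show ?thesis .
qed

lemma anticommutator_create_create:
  "create_vec m u (create_vec m v f) S = - create_vec m v (create_vec m u f) S"
proof -
  have "create_vec m u (create_vec m v f) S = (\<Sum>i<m. \<Sum>j<m. u i * (v j * create i (create j f) S))"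
    by (simp add: create_vec_def create_sum sum_distrib_left)
  also have "\<dots> = (\<Sum>j<m. \<Sum>i<m. u i * (v j * - create j (create i f) S))"
    by (subst sum.swap) (simp only: create_create[symmetric])
  also have "\<dots> = - create_vec m v (create_vec m u f) S"
    by (simp add: create_vec_def create_sum sum_distrib_left sum_negf mult_ac)
  finally show ?thesis .
qed

definition fock_inner :: "nat \<Rightarrow> (nat set \<Rightarrow> real) \<Rightarrow> (nat set \<Rightarrow> real) \<Rightarrow> real" where
  "fock_inner m f g = (\<Sum>S\<in>Pow {..<m}. f S * g S)"

abbreviation fock_sqnorm :: "nat \<Rightarrow> (nat set \<Rightarrow> real) \<Rightarrow> real" where
  "fock_sqnorm m f \<equiv> fock_inner m f f"

lemma fock_sqnorm_nonneg: "0 \<le> fock_sqnorm m f"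
  unfolding fock_inner_def by (intro sum_nonneg) simp

lemma create_annihilate_adjoint_basis:
  assumes "i < m"
  shows "fock_inner m (create i f) g = fock_inner m f (annihilate i g)"
proof -
  have "fock_inner m (create i f) g
      = (\<Sum>S\<in>{S \<in> Pow {..<m}. i \<in> S}. fock_sign i S * f (S - {i}) * g S)"
    unfolding fock_inner_def by (rule sum.mono_neutral_cong_right) (auto simp: create_def)
  also have "\<dots> = (\<Sum>T\<in>{T \<in> Pow {..<m}. i \<notin> T}. fock_sign i T * f T * g (insert i T))"
    by (rule sum.reindex_bij_witness[where i = "insert i" and j = "\<lambda>S. S - {i}"])
       (use assms in \<open>auto simp: insert_absorb\<close>)
  also have "\<dots> = fock_inner m f (annihilate i g)"
    unfolding fock_inner_def by (rule sum.mono_neutral_cong_left) (auto simp: annihilate_def)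
  finally show ?thesis .
qed

lemma create_annihilate_adjoint:
  "fock_inner m (create_vec m u f) g = fock_inner m f (annihilate_vec m u g)"
proof -
  have "fock_inner m (create_vec m u f) g = (\<Sum>i<m. u i * fock_inner m (create i f) g)"
    unfolding fock_inner_def create_vec_def sum_distrib_right sum_distrib_left
    by (subst sum.swap) (simp add: mult_ac)
  also have "\<dots> = (\<Sum>i<m. u i * fock_inner m f (annihilate i g))"
    by (simp add: create_annihilate_adjoint_basis)
  also have "\<dots> = fock_inner m f (annihilate_vec m u g)"
    unfolding fock_inner_def annihilate_vec_def sum_distrib_left
    by (subst sum.swap) (simp add: mult_ac)
  finally show ?thesis .
qed

lemma fock_inner_commute: "fock_inner m f g = fock_inner m g f"
  by (simp add: fock_inner_def mult.commute)

text \<open>Contraction with \<open>u\<close> is adjoint to multiplication by \<open>u\<close>, so this is the quadratic form of the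
anticommutator of the two. For a unit vector \<open>u\<close> it says that the number operator of \<open>u\<close> lies between \<open>0\<close> and \<open>1\<close>.\<close>

lemma sqnorm_annihilate_plus_create:
  "fock_sqnorm m (annihilate_vec m u f) + fock_sqnorm m (create_vec m u f)
     = (\<Sum>i<m. u i * u i) * fock_sqnorm m f"
proof -
  have "fock_sqnorm m (annihilate_vec m u f) = fock_inner m f (create_vec m u (annihilate_vec m u f))"
    using create_annihilate_adjoint[of m u "annihilate_vec m u f" f] by (simp add: fock_inner_commute)
  moreover have "fock_sqnorm m (create_vec m u f) = fock_inner m f (annihilate_vec m u (create_vec m u f))"
    by (rule create_annihilate_adjoint)
  ultimately have "fock_sqnorm m (annihilate_vec m u f) + fock_sqnorm m (create_vec m u f)
      = fock_inner m f (\<lambda>S. annihilate_vec m u (create_vec m u f) S + create_vec m u (annihilate_vec m u f) S)"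
    by (simp add: fock_inner_def sum.distrib algebra_simps)
  thus ?thesis
    by (simp add: anticommutator_annihilate_create fock_inner_def sum_distrib_left mult_ac)
qed

definition fock_space :: "nat \<Rightarrow> nat \<Rightarrow> (nat set \<Rightarrow> real) set" where
  "fock_space m r = {f. \<forall>S. f S \<noteq> 0 \<longrightarrow> S \<subseteq> {..<m} \<and> card S = r}"

text \<open>Summed over the standard basis, creating after annihilating counts the elements of each \<open>S\<close>, and
there are \<open>r\<close> of them.\<close>

lemma number_operator:
  assumes "f \<in> fock_space m r"
  shows "(\<Sum>i<m. fock_sqnorm m (annihilate i f)) = real r * fock_sqnorm m f"
proof -
  have "(\<Sum>i<m. fock_sqnorm m (annihilate i f)) = (\<Sum>i<m. fock_inner m (create i (annihilate i f)) f)"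
    by (intro sum.cong refl) (simp add: create_annihilate_adjoint_basis)
  also have "\<dots> = (\<Sum>S\<in>Pow {..<m}. \<Sum>i<m. if i \<in> S then f S * f S else 0)"
    unfolding fock_inner_def create_annihilate_same
    by (subst sum.swap) (intro sum.cong refl, auto)
  also have "\<dots> = (\<Sum>S\<in>Pow {..<m}. real r * (f S * f S))"
  proof (intro sum.cong refl)
    fix S assume S: "S \<in> Pow {..<m}"
    have "(\<Sum>i<m. if i \<in> S then f S * f S else 0) = (\<Sum>i\<in>S. f S * f S)"
      by (rule sum.mono_neutral_cong_right) (use S in auto)
    thus "(\<Sum>i<m. if i \<in> S then f S * f S else 0) = real r * (f S * f S)"
      using assms by (cases "f S = 0") (auto simp: fock_space_def)
  qed
  finally show ?thesis by (simp add: fock_inner_def sum_distrib_left)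
qed

section \<open>Eigenvalue sums of derivations of the exterior algebra\<close>

definition orthonormal_family :: "nat \<Rightarrow> nat \<Rightarrow> (nat \<Rightarrow> nat \<Rightarrow> real) \<Rightarrow> bool" where
  "orthonormal_family m L e \<longleftrightarrow>
     (\<forall>l<L. \<forall>l'<L. (\<Sum>i<m. e l i * e l' i) = (if l = l' then 1 else 0))"

lemma bessel_inequality:
  assumes "orthonormal_family m L e"
  shows "(\<Sum>l<L. (\<Sum>i<m. e l i * g i)\<^sup>2) \<le> (\<Sum>i<m. (g i)\<^sup>2)"
proof -
  define c where "c l = (\<Sum>i<m. e l i * g i)" for l
  have cross: "(\<Sum>i<m. g i * (\<Sum>l<L. c l * e l i)) = (\<Sum>l<L. (c l)\<^sup>2)"
  proof -
    have "(\<Sum>i<m. g i * (\<Sum>l<L. c l * e l i)) = (\<Sum>l<L. \<Sum>i<m. c l * (e l i * g i))"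
      unfolding sum_distrib_left by (subst sum.swap) (simp add: mult_ac)
    thus ?thesis by (simp add: c_def power2_eq_square flip: sum_distrib_left)
  qed
  have sq: "(\<Sum>i<m. (\<Sum>l<L. c l * e l i)\<^sup>2) = (\<Sum>l<L. (c l)\<^sup>2)"
  proof -
    have "(\<Sum>i<m. (\<Sum>l<L. c l * e l i)\<^sup>2) = (\<Sum>i<m. \<Sum>l<L. \<Sum>l'<L. c l * c l' * (e l i * e l' i))"
      unfolding power2_eq_square sum_product by (intro sum.cong refl) (simp add: mult_ac)
    also have "\<dots> = (\<Sum>l<L. \<Sum>l'<L. c l * c l' * (\<Sum>i<m. e l i * e l' i))"
      unfolding sum_distrib_left sum_rotate[where C = "{..<m}", symmetric] ..
    also have "\<dots> = (\<Sum>l<L. \<Sum>l'<L. if l' = l then (c l)\<^sup>2 else 0)"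
      by (intro sum.cong refl)
         (use assms in \<open>auto simp: orthonormal_family_def power2_eq_square\<close>)
    finally show ?thesis by simp
  qed
  \<comment> \<open>The squared length of the component of \<open>g\<close> orthogonal to the family.\<close>
  have "0 \<le> (\<Sum>i<m. (g i - (\<Sum>l<L. c l * e l i))\<^sup>2)" by (intro sum_nonneg) simp
  also have "\<dots> = (\<Sum>i<m. (g i)\<^sup>2) + (\<Sum>i<m. (\<Sum>l<L. c l * e l i)\<^sup>2)
                 - 2 * (\<Sum>i<m. g i * (\<Sum>l<L. c l * e l i))"
    by (simp add: power2_diff sum.distrib sum_subtractf mult.assoc flip: sum_distrib_left)
  finally have "(\<Sum>l<L. (c l)\<^sup>2) \<le> (\<Sum>i<m. (g i)\<^sup>2)" unfolding cross sq by simp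
  thus ?thesis by (simp add: c_def)
qed

text \<open>The quadratic form of the derivation of the exterior algebra that extends \<open>B\<close>, namely
\<open>\<Sum>\<^sub>i\<^sub>j B\<^sub>i\<^sub>j c\<^sub>i a\<^sub>j\<close> with \<open>c\<^sub>i\<close> the creation and \<open>a\<^sub>j\<close> the annihilation operators. Since \<open>c\<^sub>i\<close> is adjoint
to \<open>a\<^sub>i\<close>, the form needs annihilation operators only.\<close>

definition second_quantized_form :: "nat \<Rightarrow> (nat \<Rightarrow> nat \<Rightarrow> real) \<Rightarrow> (nat set \<Rightarrow> real) \<Rightarrow> real" where
  "second_quantized_form m B f =
     (\<Sum>K\<in>Pow {..<m}. \<Sum>i<m. \<Sum>j<m. B i j * (annihilate i f K * annihilate j f K))"

lemma second_quantized_form_spectral: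
  assumes "\<And>i j. i < m \<Longrightarrow> j < m \<Longrightarrow> B i j = (\<Sum>l<L. b l * (e l i * e l j - e' l i * e' l j))"
  shows "second_quantized_form m B f
    = (\<Sum>l<L. b l * (fock_sqnorm m (annihilate_vec m (e l) f)
                     - fock_sqnorm m (annihilate_vec m (e' l) f)))"
proof -
  have "(\<Sum>i<m. \<Sum>j<m. B i j * (annihilate i f K * annihilate j f K))
     = (\<Sum>l<L. b l * (annihilate_vec m (e l) f K * annihilate_vec m (e l) f K
                     - annihilate_vec m (e' l) f K * annihilate_vec m (e' l) f K))" for K
  proof -
    have "(\<Sum>i<m. \<Sum>j<m. B i j * (annihilate i f K * annihilate j f K))
       = (\<Sum>i<m. \<Sum>j<m. \<Sum>l<L. b l * (e l i * annihilate i f K * (e l j * annihilate j f K)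
            - e' l i * annihilate i f K * (e' l j * annihilate j f K)))"
      by (intro sum.cong refl)
         (auto simp: assms sum_distrib_right intro!: sum.cong, simp add: algebra_simps)
    also have "\<dots> = (\<Sum>l<L. \<Sum>i<m. \<Sum>j<m. b l * (e l i * annihilate i f K * (e l j * annihilate j f K)
            - e' l i * annihilate i f K * (e' l j * annihilate j f K)))"
      by (rule sum_rotate)
    also have "\<dots> = (\<Sum>l<L. b l * (annihilate_vec m (e l) f K * annihilate_vec m (e l) f K
                     - annihilate_vec m (e' l) f K * annihilate_vec m (e' l) f K))"
      unfolding annihilate_vec_def sum_product
      by (simp add: sum_distrib_left sum_subtractf right_diff_distrib)
    finally show ?thesis .
  qed
  hence "second_quantized_form m B f = (\<Sum>K\<in>Pow {..<m}. \<Sum>l<L. b l * (annihilate_vec m (e l) f K * annihilate_vec m (e l) f K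
                     - annihilate_vec m (e' l) f K * annihilate_vec m (e' l) f K))"
    by (simp add: second_quantized_form_def)
  also have "\<dots> = (\<Sum>l<L. b l * (fock_sqnorm m (annihilate_vec m (e l) f)
                     - fock_sqnorm m (annihilate_vec m (e' l) f)))"
    by (subst sum.swap) (simp add: fock_inner_def flip: sum_distrib_left sum_subtractf)
  finally show ?thesis .
qed

text \<open>A linear functional with decreasing weights on the polytope \<open>0 \<le> x\<^sub>l \<le> F\<close>, \<open>\<Sum> x\<^sub>l \<le> r F\<close> is largest
at the vertex that fills the first \<open>r\<close> coordinates: relative to that vertex, mass can only have
moved from weights at least \<open>b (r - 1)\<close> to weights at most \<open>b (r - 1)\<close>.\<close>

lemma weighted_sum_le_top_weights:
  fixes b :: "nat \<Rightarrow> real"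
  assumes dec: "\<And>l l'. l \<le> l' \<Longrightarrow> l' < L \<Longrightarrow> b l' \<le> b l"
    and nonneg: "\<And>l. l < L \<Longrightarrow> 0 \<le> b l"
    and r: "0 < r" "r \<le> L"
    and x: "\<And>l. l < L \<Longrightarrow> 0 \<le> x l" "\<And>l. l < L \<Longrightarrow> x l \<le> F"
    and total: "(\<Sum>l<L. x l) \<le> real r * F"
  shows "(\<Sum>l<L. b l * x l) \<le> (\<Sum>l<r. b l) * F"
proof -
  have top: "(\<Sum>l<r. h l) = (\<Sum>l<L. if l < r then h l else 0)" for h :: "nat \<Rightarrow> real"
    by (rule sum.mono_neutral_cong_left) (use r in auto)
  have "(\<Sum>l<L. b l * x l) - (\<Sum>l<r. b l) * F = (\<Sum>l<L. b l * (x l - (if l < r then F else 0)))"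
  proof -
    have "(\<Sum>l<r. b l) * F = (\<Sum>l<L. b l * (if l < r then F else 0))"
      unfolding sum_distrib_right top by (intro sum.cong) auto
    thus ?thesis by (simp add: sum_subtractf right_diff_distrib)
  qed
  also have "\<dots> \<le> (\<Sum>l<L. b (r - 1) * (x l - (if l < r then F else 0)))"
  proof (rule sum_mono)
    fix l assume l: "l \<in> {..<L}"
    show "b l * (x l - (if l < r then F else 0)) \<le> b (r - 1) * (x l - (if l < r then F else 0))"
    proof (cases "l < r")
      case True
      thus ?thesis using dec[of l "r - 1"] r x(2)[of l] l
        by (simp add: mult_right_mono_neg)
    next
      case False
      thus ?thesis using dec[of "r - 1" l] r x(1)[of l] l
        by (simp add: mult_right_mono)
    qed
  qed
  also have "\<dots> = b (r - 1) * ((\<Sum>l<L. x l) - real r * F)"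
    using top[of "\<lambda>_. F"] by (simp add: sum_subtractf flip: sum_distrib_left)
  also have "\<dots> \<le> 0"
    using nonneg[of "r - 1"] total r by (simp add: mult_nonneg_nonpos)
  finally show ?thesis by simp
qed

text \<open>The largest eigenvalue of an additive compound is at most the sum of the largest \<open>r\<close> eigenvalues.
The occupation numbers of the orthonormal vectors \<open>e l\<close> lie between \<open>0\<close> and the squared norm of \<open>f\<close>,
and by Bessel's inequality their total is at most \<open>r\<close> times that squared norm; the family \<open>e'\<close>, which
carries the negative eigenvalues, only lowers the value.\<close>

lemma second_quantized_form_le:
  assumes B: "\<And>i j. i < m \<Longrightarrow> j < m \<Longrightarrow> B i j = (\<Sum>l<L. b l * (e l i * e l j - e' l i * e' l j))"
    and e: "orthonormal_family m L e"
    and dec: "\<And>l l'. l \<le> l' \<Longrightarrow> l' < L \<Longrightarrow> b l' \<le> b l"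
    and nonneg: "\<And>l. l < L \<Longrightarrow> 0 \<le> b l"
    and r: "0 < r" "r \<le> L" and f: "f \<in> fock_space m r"
  shows "second_quantized_form m B f \<le> (\<Sum>l<r. b l) * fock_sqnorm m f"
proof -
  have spectral: "second_quantized_form m B f
      = (\<Sum>l<L. b l * (fock_sqnorm m (annihilate_vec m (e l) f)
                     - fock_sqnorm m (annihilate_vec m (e' l) f)))"
    by (rule second_quantized_form_spectral) (rule B)
  have "second_quantized_form m B f
     \<le> (\<Sum>l<L. b l * fock_sqnorm m (annihilate_vec m (e l) f))"
    unfolding spectral
    by (intro sum_mono mult_left_mono) (auto simp: nonneg fock_sqnorm_nonneg)
  also have "\<dots> \<le> (\<Sum>l<r. b l) * fock_sqnorm m f"
  proof (rule weighted_sum_le_top_weights[OF dec nonneg r])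
    fix l assume l: "l < L"
    show "fock_sqnorm m (annihilate_vec m (e l) f) \<le> fock_sqnorm m f"
      using sqnorm_annihilate_plus_create[of m "e l" f] fock_sqnorm_nonneg[of m "create_vec m (e l) f"]
        e l by (simp add: orthonormal_family_def)
  next
    have "(\<Sum>l<L. fock_sqnorm m (annihilate_vec m (e l) f))
       = (\<Sum>K\<in>Pow {..<m}. \<Sum>l<L. (\<Sum>i<m. e l i * annihilate i f K)\<^sup>2)"
      unfolding fock_inner_def annihilate_vec_def power2_eq_square by (rule sum.swap)
    also have "\<dots> \<le> (\<Sum>K\<in>Pow {..<m}. \<Sum>i<m. (annihilate i f K)\<^sup>2)"
      by (intro sum_mono bessel_inequality[OF e])
    also have "\<dots> = (\<Sum>i<m. fock_sqnorm m (annihilate i f))"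
      unfolding fock_inner_def power2_eq_square by (rule sum.swap)
    also have "\<dots> = real r * fock_sqnorm m f" by (rule number_operator[OF f])
    finally show "(\<Sum>l<L. fock_sqnorm m (annihilate_vec m (e l) f)) \<le> real r * fock_sqnorm m f" .
  qed (auto simp: fock_sqnorm_nonneg)
  finally show ?thesis .
qed

text \<open>The wedge \<open>e (r - 1) \<and> \<dots> \<and> e 0\<close>, built by creation operators from the vacuum.\<close>

fun slater :: "nat \<Rightarrow> (nat \<Rightarrow> nat \<Rightarrow> real) \<Rightarrow> nat \<Rightarrow> nat set \<Rightarrow> real" where
  "slater m e 0 = (\<lambda>S. if S = {} then 1 else 0)"
| "slater m e (Suc r) = create_vec m (e r) (slater m e r)"

lemma slater_in_fock_space: "slater m e r \<in> fock_space m r"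
proof (induction r)
  case (Suc r)
  {
    fix S assume "create_vec m (e r) (slater m e r) S \<noteq> 0"
    then obtain i where i: "i < m" "create i (slater m e r) S \<noteq> 0"
      unfolding create_vec_def by (metis (no_types, lifting) lessThan_iff mult_zero_right sum.neutral)
    hence "i \<in> S" "slater m e r (S - {i}) \<noteq> 0" by (auto simp: create_def split: if_splits)
    with Suc have "S - {i} \<subseteq> {..<m}" "card (S - {i}) = r" by (auto simp: fock_space_def)
    hence "S \<subseteq> {..<m}" "card S = Suc r"
      using i(1) \<open>i \<in> S\<close> finite_subset[of "S - {i}" "{..<m}"] card.remove[of S i] by auto
  }
  thus ?case by (auto simp: fock_space_def)
qed (auto simp: fock_space_def)

lemma annihilate_slater_orthogonal:
  assumes "\<And>l. l < r \<Longrightarrow> (\<Sum>i<m. v i * e l i) = 0"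
  shows "annihilate_vec m v (slater m e r) = (\<lambda>S. 0)"
  using assms
proof (induction r)
  case 0
  have "v i * annihilate i (slater m e 0) S = 0" for i S by (simp add: annihilate_def)
  thus ?case by (simp add: annihilate_vec_def del: mult_eq_0_iff)
next
  case (Suc r)
  have "annihilate_vec m v (slater m e r) = (\<lambda>S. 0)" using Suc by simp
  moreover have "create_vec m (e r) (\<lambda>S. 0) S = 0" for S
    unfolding create_vec_def create_def by (rule sum.neutral) auto
  ultimately show ?case
    using anticommutator_annihilate_create[of m v "e r" "slater m e r"] Suc.prems[of r] by auto
qed

lemma create_slater_repeated:
  assumes "l < r"
  shows "create_vec m (e l) (slater m e r) = (\<lambda>S. 0)"
  using assms
proof (induction r)
  case (Suc r)
  show ?case
  proof (cases "l = r")
    case True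
    have "create_vec m (e l) (slater m e (Suc r)) S = 0" for S
      using anticommutator_create_create[of m "e l" "e l" "slater m e r" S] True by simp
    thus ?thesis by auto
  next
    case False
    hence "create_vec m (e l) (slater m e r) = (\<lambda>S. 0)" using Suc by simp
    moreover have "create_vec m (e r) (\<lambda>S. 0) S = 0" for S
      unfolding create_vec_def create_def by (rule sum.neutral) auto
    ultimately show ?thesis
      using anticommutator_create_create[of m "e l" "e r" "slater m e r"] by auto
  qed
qed simp

lemma sqnorm_slater:
  assumes "orthonormal_family m L e" "r \<le> L"
  shows "fock_sqnorm m (slater m e r) = 1"
  using assms(2)
proof (induction r)
  case 0
  have "fock_sqnorm m (slater m e 0) = (\<Sum>S\<in>Pow {..<m}. if S = {} then 1 else 0)"
    unfolding fock_inner_def by (intro sum.cong) auto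
  thus ?case by (simp add: sum.delta)
next
  case (Suc r)
  have "annihilate_vec m (e r) (slater m e r) = (\<lambda>S. 0)"
    by (rule annihilate_slater_orthogonal) (use assms(1) Suc.prems in \<open>auto simp: orthonormal_family_def\<close>)
  moreover have "(\<Sum>i<m. e r i * e r i) = 1"
    using assms(1) Suc.prems by (simp add: orthonormal_family_def)
  ultimately show ?case
    using sqnorm_annihilate_plus_create[of m "e r" "slater m e r"] Suc by (simp add: fock_inner_def)
qed

text \<open>In the wedge of the first \<open>r\<close> vectors these vectors have occupation number \<open>1\<close>, because creating one of
them again gives \<open>0\<close>, and all vectors orthogonal to them have occupation number \<open>0\<close>. So the bound
of \<open>second_quantized_form_le\<close> is attained here.\<close>

lemma second_quantized_form_slater:
  assumes B: "\<And>i j. i < m \<Longrightarrow> j < m \<Longrightarrow> B i j = (\<Sum>l<L. b l * (e l i * e l j - e' l i * e' l j))"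
    and e: "orthonormal_family m L e"
    and ee': "\<And>l l'. l < L \<Longrightarrow> l' < L \<Longrightarrow> (\<Sum>i<m. e' l i * e l' i) = 0"
    and r: "r \<le> L"
  shows "second_quantized_form m B (slater m e r) = (\<Sum>l<r. b l)"
proof -
  let ?w = "slater m e r"
  have spectral: "second_quantized_form m B ?w
      = (\<Sum>l<L. b l * (fock_sqnorm m (annihilate_vec m (e l) ?w)
                     - fock_sqnorm m (annihilate_vec m (e' l) ?w)))"
    by (rule second_quantized_form_spectral) (rule B)
  have zero: "fock_sqnorm m (\<lambda>S. 0) = 0" by (simp add: fock_inner_def)
  have neg: "fock_sqnorm m (annihilate_vec m (e' l) ?w) = 0" if "l < L" for l
    using annihilate_slater_orthogonal[where r = r and m = m and v = "e' l" and e = e] that ee' r zero by simp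
  have pos: "fock_sqnorm m (annihilate_vec m (e l) ?w) = (if l < r then 1 else 0)" if l: "l < L" for l
  proof (cases "l < r")
    case True
    have "(\<Sum>i<m. e l i * e l i) = 1" using e l by (simp add: orthonormal_family_def)
    thus ?thesis
      using True sqnorm_annihilate_plus_create[of m "e l" ?w] sqnorm_slater[OF e r] zero
      by (simp add: create_slater_repeated)
  next
    case False
    thus ?thesis
      using annihilate_slater_orthogonal[where r = r and m = m and v = "e l" and e = e] l e r zero
      by (simp add: orthonormal_family_def)
  qed
  have "second_quantized_form m B ?w = (\<Sum>l<L. if l < r then b l else 0)"
    unfolding spectral
    by (intro sum.cong refl) (simp add: pos neg)
  also have "\<dots> = (\<Sum>l<r. b l)"
    by (rule sum.mono_neutral_cong_right) (use r in auto)
  finally show ?thesis .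
qed

section \<open>Additive compounds as derivations\<close>

lemma subseqs_strict_sorted:
  "ys \<in> set (subseqs xs) \<Longrightarrow> sorted_wrt (<) xs \<Longrightarrow> sorted_wrt (<) ys \<and> set ys \<subseteq> set xs"
  by (induction xs arbitrary: ys) (auto simp: Let_def; blast)+

lemma wedge_index_memD:
  assumes "I \<in> set (wedge_index m r)"
  shows "sorted_wrt (<) I" "length I = r" "set I \<subseteq> {..<m}"
  using assms subseqs_strict_sorted[of I "[0..<m]"] by (auto simp: wedge_index_def)

lemma strict_sorted_list_distinct: "sorted_wrt (<) (I :: nat list) \<Longrightarrow> distinct I"
  by (simp add: strict_sorted_iff)

lemma wedge_index_bij:
  "bij_betw (\<lambda>a. set (wedge_index m r ! a)) {..<m choose r} {S. S \<subseteq> {..<m} \<and> card S = r}"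
proof -
  have "distinct (map set (wedge_index m r))"
    unfolding wedge_index_def by (rule distinct_map_filter) (simp add: distinct_set_subseqs)
  hence "inj_on (\<lambda>a. set (wedge_index m r ! a)) {..<m choose r}"
    by (auto simp: inj_on_def distinct_conv_nth length_wedge_index)
  moreover have "(\<lambda>a. set (wedge_index m r ! a)) ` {..<m choose r} = set ` set (wedge_index m r)"
    by (auto simp: set_conv_nth length_wedge_index image_iff)
  moreover have "set ` set (wedge_index m r) = {S. S \<subseteq> {..<m} \<and> card S = r}"
  proof (intro equalityI subsetI)
    fix S assume "S \<in> set ` set (wedge_index m r)"
    thus "S \<in> {S. S \<subseteq> {..<m} \<and> card S = r}"
      using wedge_index_memD[of _ m r] by (auto simp: distinct_card strict_sorted_list_distinct)
  next
    fix S assume S: "S \<in> {S. S \<subseteq> {..<m} \<and> card S = r}"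
    then obtain I where I: "I \<in> set (subseqs [0..<m])" "S = set I"
      using subset_subseqs[of S "[0..<m]"] by (auto simp: atLeast0LessThan)
    hence "length I = r" using S subseqs_distinctD[OF I(1)] by (simp add: distinct_card)
    thus "S \<in> set ` set (wedge_index m r)" using I by (auto simp: wedge_index_def)
  qed
  ultimately show ?thesis by (simp add: bij_betw_def)
qed

text \<open>This is the minor of the identity matrix with rows \<open>I\<close> and columns \<open>J\<close>.\<close>

lemma det_strict_sorted_incidence:
  fixes I J :: "nat list"
  assumes "sorted_wrt (<) I" "sorted_wrt (<) J" "length I = s" "length J = s"
  shows "det (mat s s (\<lambda>(p, q). if I ! p = J ! q then 1 else 0)) = (if set I = set J then 1 else (0::real))"
proof (cases "set I = set J")
  case True
  have IJ: "I = J" using assms True by (simp add: strict_sorted_equal)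
  have "mat s s (\<lambda>(p, q). if I ! p = J ! q then 1 else 0) = (1\<^sub>m s :: real mat)"
    using strict_sorted_list_distinct[OF assms(2)] assms(4)
    by (intro eq_matI) (auto simp: IJ nth_eq_iff_index_eq)
  thus ?thesis using True by simp
next
  case False
  let ?M = "mat s s (\<lambda>(p, q). if I ! p = J ! q then 1 else 0) :: real mat"
  have "card (set I) = card (set J)"
    using assms by (simp add: distinct_card strict_sorted_list_distinct)
  hence "\<not> set J \<subseteq> set I" using False card_subset_eq[of "set I" "set J"] by auto
  then obtain q where q: "q < s" "J ! q \<notin> set I" using assms(4) by (auto simp: set_conv_nth)
  have "det ?M = (\<Sum>p<s. ?M $$ (p, q) * cofactor ?M p q)"
    by (rule laplace_expansion_column) (use q in auto)
  also have "\<dots> = 0"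
  proof (rule sum.neutral, safe)
    fix p assume p: "p < s"
    hence "I ! p \<noteq> J ! q" using q(2) assms(3) nth_mem by metis
    thus "?M $$ (p, q) * cofactor ?M p q = 0" using p q(1) by simp
  qed
  finally show ?thesis using False by simp
qed

lemma fock_sign_nth:
  assumes "sorted_wrt (<) I" "p < length I"
  shows "fock_sign (I ! p) (set I) = (-1) ^ p"
proof -
  have less: "I ! q < I ! p \<longleftrightarrow> q < p" if "q < length I" for q
    using sorted_wrt_nth_less[OF assms(1), of q p] sorted_wrt_nth_less[OF assms(1), of p q] assms(2) that
    by (metis linorder_neqE_nat not_less_iff_gr_or_eq)
  have "{s \<in> set I. s < I ! p} = (!) I ` {..<p}"
    using less assms(2) by (auto simp: set_conv_nth)
  moreover have "inj_on ((!) I) {..<p}"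
    using strict_sorted_list_distinct[OF assms(1)] assms(2) by (auto simp: inj_on_def nth_eq_iff_index_eq)
  ultimately have "card {s \<in> set I. s < I ! p} = p" by (simp add: card_image)
  thus ?thesis by (simp add: fock_sign_def)
qed

lemma remove_nth_strict_sorted:
  fixes I :: "nat list"
  assumes "sorted_wrt (<) I" "p < length I"
  defines "I' \<equiv> take p I @ drop (Suc p) I"
  shows "sorted_wrt (<) I'" "length I' = length I - 1" "set I' = set I - {I ! p}"
    "\<And>q. q < length I' \<Longrightarrow> I' ! q = I ! (if q < p then q else Suc q)"
proof -
  have I: "I = take p I @ I ! p # drop (Suc p) I" using assms(2) by (rule id_take_nth_drop)
  have "sorted_wrt (<) (take p I @ I ! p # drop (Suc p) I)" using assms(1) I by simp
  thus "sorted_wrt (<) I'" unfolding I'_def by (auto simp: sorted_wrt_append)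
  show "length I' = length I - 1" using assms(2) by (simp add: I'_def)
  have "distinct (take p I @ I ! p # drop (Suc p) I)"
    using strict_sorted_list_distinct[OF assms(1)] I by simp
  moreover have "set I = set (take p I @ I ! p # drop (Suc p) I)" using I by simp
  ultimately show "set I' = set I - {I ! p}" unfolding I'_def by auto
  show "I' ! q = I ! (if q < p then q else Suc q)" if "q < length I'" for q
    using that assms(2) by (auto simp: I'_def nth_append min_def)
qed

text \<open>Laplace expansion along the replaced column: the complementary minors belong to the identity
matrix, so they are \<open>0\<close> or \<open>1\<close>, and the cofactor sign \<open>(-1)^(p + q)\<close> is the product of the
two signs with which \<open>I ! p\<close> and \<open>J ! q\<close> are taken out of their index sets.\<close>

lemma wedge_replace_coordinate:
  assumes I: "sorted_wrt (<) I" "length I = r" "set I \<subseteq> {..<m}"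
    and J: "sorted_wrt (<) J" "length J = r" "set J \<subseteq> {..<m}"
    and a: "a < m choose r" "wedge_index m r ! a = I"
    and q: "q < r" and x: "x \<in> carrier_vec m"
  shows "wedge m ((map (unit_vec m) J)[q := x]) $ a
    = (\<Sum>i\<in>set I. x $ i * (fock_sign i (set I) * fock_sign (J ! q) (set J))
                   * (if set I - {i} = set J - {J ! q} then 1 else 0))"
proof -
  let ?vs = "(map (unit_vec m) J)[q := x]"
  define M where "M = mat r r (\<lambda>(p, q'). ?vs ! q' $ (I ! p))"
  have M: "M \<in> carrier_mat r r" by (simp add: M_def)
  have Im: "I ! p < m" if "p < r" for p using I that by (auto simp: subset_iff)
  have Jm: "J ! p < m" if "p < r" for p using J that by (auto simp: subset_iff)
  have minor: "det (mat_delete M p q) = (if set I - {I ! p} = set J - {J ! q} then 1 else 0)"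
    if p: "p < r" for p
  proof -
    let ?I = "take p I @ drop (Suc p) I" and ?J = "take q J @ drop (Suc q) J"
    note Ip = remove_nth_strict_sorted[OF I(1), of p] and Jq = remove_nth_strict_sorted[OF J(1), of q]
    have "mat_delete M p q = mat (r - 1) (r - 1) (\<lambda>(p', q'). if ?I ! p' = ?J ! q' then 1 else 0)"
    proof (rule eq_matI)
      fix p' q' assume "p' < dim_row (mat (r - 1) (r - 1) (\<lambda>(p', q'). if ?I ! p' = ?J ! q' then 1 else 0 :: real))"
        and "q' < dim_col (mat (r - 1) (r - 1) (\<lambda>(p', q'). if ?I ! p' = ?J ! q' then 1 else 0 :: real))"
      hence pq: "p' < r - 1" "q' < r - 1" by auto
      define p2 where "p2 = (if p' < p then p' else Suc p')"
      define q2 where "q2 = (if q' < q then q' else Suc q')"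
      have r2: "p2 < r" "q2 < r" "q2 \<noteq> q" using pq p q by (auto simp: p2_def q2_def)
      have "mat_delete M p q $$ (p', q') = M $$ (p2, q2)"
        using pq M by (simp add: mat_delete_def p2_def q2_def)
      also have "\<dots> = unit_vec m (J ! q2) $ (I ! p2)" using r2 J by (simp add: M_def)
      also have "\<dots> = (if ?I ! p' = ?J ! q' then 1 else 0)"
        using Ip(4)[of p'] Jq(4)[of q'] Ip(2) Jq(2) pq p q I J r2 Im[of p2] Jm[of q2]
        by (simp add: p2_def q2_def)
      finally show "mat_delete M p q $$ (p', q')
          = mat (r - 1) (r - 1) (\<lambda>(p', q'). if ?I ! p' = ?J ! q' then 1 else 0) $$ (p', q')"
        using pq by simp
    qed (use M in auto)
    thus ?thesis
      using det_strict_sorted_incidence[of ?I ?J "r - 1"] Ip Jq p q I J by simp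
  qed
  have "wedge m ?vs $ a = det M"
    using a J by (simp add: wedge_def Let_def M_def)
  also have "\<dots> = (\<Sum>p<r. M $$ (p, q) * cofactor M p q)"
    by (rule laplace_expansion_column[OF M q])
  also have "\<dots> = (\<Sum>p<r. x $ (I ! p) * (fock_sign (I ! p) (set I) * fock_sign (J ! q) (set J))
                   * (if set I - {I ! p} = set J - {J ! q} then 1 else 0))"
    using I J q
    by (intro sum.cong refl) (simp add: M_def[THEN arg_cong[where f = "\<lambda>M. M $$ _"]]
       cofactor_def minor fock_sign_nth power_add)
  also have "\<dots> = (\<Sum>i\<in>set I. x $ i * (fock_sign i (set I) * fock_sign (J ! q) (set J))
                   * (if set I - {i} = set J - {J ! q} then 1 else 0))"
    by (rule sum.reindex_bij_betw[OF bij_betw_nth, of I])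
       (use I strict_sorted_list_distinct in auto)
  finally show ?thesis .
qed

text \<open>The matrix entry between \<open>e\<^sub>S\<close> and \<open>e\<^sub>T\<close> of \<open>\<Sum>\<^sub>i\<^sub>j B\<^sub>i\<^sub>j c\<^sub>i a\<^sub>j\<close>: removing \<open>j\<close> from \<open>T\<close> and inserting \<open>i\<close> must
give \<open>S\<close>.\<close>

definition compound_coefficient :: "(nat \<Rightarrow> nat \<Rightarrow> real) \<Rightarrow> nat set \<Rightarrow> nat set \<Rightarrow> real" where
  "compound_coefficient B S T =
     (\<Sum>i\<in>S. \<Sum>j\<in>T. B i j * (fock_sign i S * fock_sign j T) * (if S - {i} = T - {j} then 1 else 0))"

lemma additive_compound_carrier:
  assumes "B \<in> carrier_mat m m"
  shows "additive_compound r B \<in> carrier_mat (m choose r) (m choose r)"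
  using assms by (auto simp: additive_compound_def Let_def length_wedge_index)

lemma additive_compound_entry:
  assumes B: "B \<in> carrier_mat m m" and a: "a < m choose r" and b: "b < m choose r"
  shows "additive_compound r B $$ (a, b)
    = compound_coefficient (\<lambda>i j. B $$ (i, j)) (set (wedge_index m r ! a)) (set (wedge_index m r ! b))"
proof -
  define I where "I = wedge_index m r ! a"
  define J where "J = wedge_index m r ! b"
  note I = wedge_index_memD[of I m r, unfolded I_def, OF nth_mem, folded I_def, unfolded length_wedge_index, OF a]
  note J = wedge_index_memD[of J m r, unfolded J_def, OF nth_mem, folded J_def, unfolded length_wedge_index, OF b]
  have len: "length (map (unit_vec m) J) = r" using J by simp
  have "additive_compound r B $$ (a, b) = wedge_derivation B (map (unit_vec m) J) $ a"
    using a b B by (simp add: additive_compound_def Let_def J_def mat_of_cols_index length_wedge_index)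
  also have "\<dots> = (\<Sum>q<r. wedge m ((map (unit_vec m) J)[q := B *\<^sub>v (map (unit_vec m) J ! q)]) $ a)"
    using a B len by (simp add: wedge_derivation_def Let_def)
  also have "\<dots> = (\<Sum>q<r. \<Sum>i\<in>set I. B $$ (i, J ! q) * (fock_sign i (set I) * fock_sign (J ! q) (set J))
                   * (if set I - {i} = set J - {J ! q} then 1 else 0))"
  proof (rule sum.cong[OF refl])
    fix q assume q: "q \<in> {..<r}"
    hence Jq: "J ! q < m" using J by (auto simp: subset_iff)
    have "B *\<^sub>v (map (unit_vec m) J ! q) = col B (J ! q)"
      using q J B Jq by (intro eq_vecI) (auto simp: scalar_prod_right_unit)
    moreover have "(\<Sum>i\<in>set I. col B (J ! q) $ i * (fock_sign i (set I) * fock_sign (J ! q) (set J))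
                   * (if set I - {i} = set J - {J ! q} then 1 else 0))
       = (\<Sum>i\<in>set I. B $$ (i, J ! q) * (fock_sign i (set I) * fock_sign (J ! q) (set J))
                   * (if set I - {i} = set J - {J ! q} then 1 else 0))"
      using I B Jq by (intro sum.cong refl) (auto simp: subset_iff)
    moreover have "col B (J ! q) \<in> carrier_vec m" using B Jq by (auto simp: col_def)
    ultimately show "wedge m ((map (unit_vec m) J)[q := B *\<^sub>v (map (unit_vec m) J ! q)]) $ a
       = (\<Sum>i\<in>set I. B $$ (i, J ! q) * (fock_sign i (set I) * fock_sign (J ! q) (set J))
                   * (if set I - {i} = set J - {J ! q} then 1 else 0))"
      using wedge_replace_coordinate[OF I J a I_def[symmetric], of q "col B (J ! q)"] q B by simp
  qed
  also have "\<dots> = (\<Sum>j\<in>set J. \<Sum>i\<in>set I. B $$ (i, j) * (fock_sign i (set I) * fock_sign j (set J))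
                   * (if set I - {i} = set J - {j} then 1 else 0))"
    by (rule sum.reindex_bij_betw[OF bij_betw_nth, of J])
       (use J strict_sorted_list_distinct in auto)
  also have "\<dots> = compound_coefficient (\<lambda>i j. B $$ (i, j)) (set I) (set J)"
    unfolding compound_coefficient_def by (rule sum.swap)
  finally show ?thesis by (simp add: I_def J_def)
qed

lemma compound_coefficient_symmetric:
  assumes "\<And>i j. i \<in> S \<Longrightarrow> j \<in> T \<Longrightarrow> B i j = B j i"
  shows "compound_coefficient B S T = compound_coefficient B T S"
  unfolding compound_coefficient_def
  by (subst sum.swap) (intro sum.cong refl, auto simp: assms mult.commute)

lemma annihilate_as_sum:
  assumes "K \<in> Pow {..<m}" "i < m"
  shows "annihilate i f K
    = (\<Sum>S\<in>Pow {..<m}. if S - {i} = K \<and> i \<in> S then fock_sign i S * f S else 0)"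
proof -
  have "(\<Sum>S\<in>Pow {..<m}. if S - {i} = K \<and> i \<in> S then fock_sign i S * f S else 0)
      = (\<Sum>S\<in>Pow {..<m}. if S = insert i K then annihilate i f K else 0)"
    by (intro sum.cong refl) (auto simp: annihilate_def insert_absorb)
  also have "\<dots> = annihilate i f K" using assms by (simp add: sum.delta)
  finally show ?thesis by simp
qed

text \<open>Group the pairs \<open>S\<close>, \<open>T\<close> with \<open>S - {i} = T - {j}\<close> by this common set \<open>K\<close>.\<close>

lemma second_quantized_form_eq_compound:
  "second_quantized_form m B f
     = (\<Sum>S\<in>Pow {..<m}. \<Sum>T\<in>Pow {..<m}. f S * compound_coefficient B S T * f T)"
proof -
  let ?P = "Pow {..<m}"
  define g where "g i S = (if i \<in> S then fock_sign i S * f S else 0)" for i S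
  have ann: "annihilate i f K = (\<Sum>S\<in>?P. if S - {i} = K then g i S else 0)"
    if "K \<in> ?P" "i < m" for i K
    unfolding annihilate_as_sum[OF that] by (intro sum.cong) (auto simp: g_def)
  have entry: "f S * compound_coefficient B S T * f T
     = (\<Sum>i<m. \<Sum>j<m. B i j * (if S - {i} = T - {j} then g i S * g j T else 0))"
    if S: "S \<in> ?P" and T: "T \<in> ?P" for S T
  proof -
    have "f S * compound_coefficient B S T * f T
       = (\<Sum>i\<in>S. \<Sum>j\<in>T. B i j * (if S - {i} = T - {j} then g i S * g j T else 0))"
      unfolding compound_coefficient_def sum_distrib_left sum_distrib_right
      by (intro sum.cong refl) (auto simp: g_def)
    also have "\<dots> = (\<Sum>i\<in>S. \<Sum>j<m. B i j * (if S - {i} = T - {j} then g i S * g j T else 0))"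
      by (intro sum.cong refl sum.mono_neutral_left) (use T in \<open>auto simp: g_def\<close>)
    also have "\<dots> = (\<Sum>i<m. \<Sum>j<m. B i j * (if S - {i} = T - {j} then g i S * g j T else 0))"
      by (intro sum.mono_neutral_left) (use S in \<open>auto simp: g_def intro!: sum.neutral\<close>)
    finally show ?thesis .
  qed
  have pair: "(\<Sum>K\<in>?P. annihilate i f K * annihilate j f K)
     = (\<Sum>S\<in>?P. \<Sum>T\<in>?P. if S - {i} = T - {j} then g i S * g j T else 0)"
    if i: "i < m" and j: "j < m" for i j
  proof -
    have "(\<Sum>K\<in>?P. annihilate i f K * annihilate j f K)
       = (\<Sum>K\<in>?P. \<Sum>S\<in>?P. \<Sum>T\<in>?P. (if S - {i} = K then g i S else 0) * (if T - {j} = K then g j T else 0))"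
      by (intro sum.cong refl) (simp add: ann i j sum_product)
    also have "\<dots> = (\<Sum>S\<in>?P. \<Sum>T\<in>?P. \<Sum>K\<in>?P. (if S - {i} = K then g i S else 0) * (if T - {j} = K then g j T else 0))"
      by (rule sum_rotate[symmetric])
    also have "\<dots> = (\<Sum>S\<in>?P. \<Sum>T\<in>?P. \<Sum>K\<in>?P. if K = S - {i} then (if S - {i} = T - {j} then g i S * g j T else 0) else 0)"
      by (intro sum.cong refl) auto
    also have "\<dots> = (\<Sum>S\<in>?P. \<Sum>T\<in>?P. if S - {i} = T - {j} then g i S * g j T else 0)"
      by (intro sum.cong refl) (subst sum.delta, auto)
    finally show ?thesis .
  qed
  have "second_quantized_form m B f = (\<Sum>i<m. \<Sum>j<m. \<Sum>K\<in>?P. B i j * (annihilate i f K * annihilate j f K))"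
    unfolding second_quantized_form_def by (rule sum_rotate[symmetric])
  also have "\<dots> = (\<Sum>i<m. \<Sum>j<m. \<Sum>S\<in>?P. \<Sum>T\<in>?P. B i j * (if S - {i} = T - {j} then g i S * g j T else 0))"
    by (rule sum.cong[OF refl], rule sum.cong[OF refl])
       (simp only: sum_distrib_left[symmetric] pair lessThan_iff)
  also have "\<dots> = (\<Sum>S\<in>?P. \<Sum>i<m. \<Sum>j<m. \<Sum>T\<in>?P. B i j * (if S - {i} = T - {j} then g i S * g j T else 0))"
    by (rule sum_rotate)
  also have "\<dots> = (\<Sum>S\<in>?P. \<Sum>T\<in>?P. \<Sum>i<m. \<Sum>j<m. B i j * (if S - {i} = T - {j} then g i S * g j T else 0))"
    by (intro sum.cong refl sum_rotate)
  also have "\<dots> = (\<Sum>S\<in>?P. \<Sum>T\<in>?P. f S * compound_coefficient B S T * f T)"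
    by (intro sum.cong refl) (subst entry, auto)
  finally show ?thesis .
qed

lemma sum_wedge_index:
  "(\<Sum>a<m choose r. h (set (wedge_index m r ! a))) = (\<Sum>S\<in>{S. S \<subseteq> {..<m} \<and> card S = r}. h S)"
  by (rule sum.reindex_bij_betw[OF wedge_index_bij])

lemma fock_space_sum:
  assumes "f \<in> fock_space m r" "\<And>S. f S = 0 \<Longrightarrow> h S = 0"
  shows "(\<Sum>S\<in>{S. S \<subseteq> {..<m} \<and> card S = r}. h S) = (\<Sum>S\<in>Pow {..<m}. (h S :: real))"
  by (rule sum.mono_neutral_left) (use assms in \<open>auto simp: fock_space_def\<close>)

definition fock_coordinates :: "nat \<Rightarrow> nat \<Rightarrow> (nat set \<Rightarrow> real) \<Rightarrow> real vec" where
  "fock_coordinates m r f = vec (m choose r) (\<lambda>a. f (set (wedge_index m r ! a)))"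

lemma fock_coordinates_surj:
  assumes "v \<in> carrier_vec (m choose r)"
  obtains f where "f \<in> fock_space m r" "fock_coordinates m r f = v"
proof
  let ?X = "{S. S \<subseteq> {..<m} \<and> card S = r}"
  let ?\<phi> = "\<lambda>a. set (wedge_index m r ! a)"
  let ?f = "\<lambda>S. if S \<in> ?X then v $ inv_into {..<m choose r} ?\<phi> S else 0"
  show "?f \<in> fock_space m r" by (auto simp: fock_space_def)
  have "?\<phi> a \<in> ?X" if "a < m choose r" for a
    using wedge_index_bij[of m r] that by (blast dest: bij_betwE)
  moreover have "inv_into {..<m choose r} ?\<phi> (?\<phi> a) = a" if "a < m choose r" for a
    using wedge_index_bij[of m r] that by (intro inv_into_f_f) (auto simp: bij_betw_def)
  ultimately show "fock_coordinates m r ?f = v"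
    using assms by (intro eq_vecI) (auto simp: fock_coordinates_def)
qed

lemma fock_coordinates_sqnorm:
  assumes "f \<in> fock_space m r"
  shows "fock_coordinates m r f \<bullet> fock_coordinates m r f = fock_sqnorm m f"
proof -
  have "fock_coordinates m r f \<bullet> fock_coordinates m r f
      = (\<Sum>a<m choose r. f (set (wedge_index m r ! a)) * f (set (wedge_index m r ! a)))"
    by (simp add: fock_coordinates_def scalar_prod_def atLeast0LessThan)
  also have "\<dots> = fock_sqnorm m f"
    unfolding fock_inner_def sum_wedge_index[of "\<lambda>S. f S * f S"]
    by (rule fock_space_sum[OF assms]) simp
  finally show ?thesis .
qed

lemma additive_compound_quadratic_form:
  assumes B: "B \<in> carrier_mat m m" and f: "f \<in> fock_space m r"
  shows "fock_coordinates m r f \<bullet> (additive_compound r B *\<^sub>v fock_coordinates m r f)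
    = second_quantized_form m (\<lambda>i j. B $$ (i, j)) f"
proof -
  let ?B = "\<lambda>i j. B $$ (i, j)" and ?X = "{S. S \<subseteq> {..<m} \<and> card S = r}"
  let ?\<phi> = "\<lambda>a. set (wedge_index m r ! a)"
  have "fock_coordinates m r f \<bullet> (additive_compound r B *\<^sub>v fock_coordinates m r f)
     = (\<Sum>a<m choose r. \<Sum>b<m choose r. f (?\<phi> a) * compound_coefficient ?B (?\<phi> a) (?\<phi> b) * f (?\<phi> b))"
    using additive_compound_carrier[OF B, of r]
    by (simp add: fock_coordinates_def scalar_prod_def atLeast0LessThan additive_compound_entry[OF B]
        sum_distrib_left mult.assoc)
  also have "\<dots> = (\<Sum>S\<in>?X. \<Sum>T\<in>?X. f S * compound_coefficient ?B S T * f T)"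
    unfolding sum_wedge_index[of "\<lambda>T. f _ * compound_coefficient ?B _ T * f T"]
    by (rule sum_wedge_index[of "\<lambda>S. \<Sum>T\<in>?X. f S * compound_coefficient ?B S T * f T"])
  also have "\<dots> = (\<Sum>S\<in>?X. \<Sum>T\<in>Pow {..<m}. f S * compound_coefficient ?B S T * f T)"
    by (intro sum.cong refl fock_space_sum[OF f]) simp
  also have "\<dots> = second_quantized_form m ?B f"
    unfolding second_quantized_form_eq_compound by (rule fock_space_sum[OF f]) simp
  finally show ?thesis .
qed

text \<open>This reformulation replaces the matrix on \<open>m choose r\<close> coordinates by an inequality that is linear
in \<open>B\<close>, and which the anticommutation relations can prove or refute.\<close>

lemma psd_additive_compound_iff:
  assumes B: "B \<in> carrier_mat m m" "transpose_mat B = B"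
  shows "psd_mat (c \<cdot>\<^sub>m 1\<^sub>m (m choose r) - additive_compound r B)
    \<longleftrightarrow> (\<forall>f\<in>fock_space m r. second_quantized_form m (\<lambda>i j. B $$ (i, j)) f \<le> c * fock_sqnorm m f)"
proof -
  let ?d = "m choose r" and ?L = "additive_compound r B"
  let ?M = "c \<cdot>\<^sub>m 1\<^sub>m ?d - ?L"
  note L = additive_compound_carrier[OF B(1), of r]
  have sym: "B $$ (i, j) = B $$ (j, i)" if "i < m" "j < m" for i j
    using that B by (metis carrier_matD index_transpose_mat(1))
  have Lsym: "?L $$ (a, b) = ?L $$ (b, a)" if ab: "a < ?d" "b < ?d" for a b
  proof -
    have sub: "set (wedge_index m r ! a) \<subseteq> {..<m}" if "a < ?d" for a
      using that wedge_index_memD(3)[of "wedge_index m r ! a" m r] by (simp add: length_wedge_index)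
    show ?thesis
      unfolding additive_compound_entry[OF B(1) ab] additive_compound_entry[OF B(1) ab(2,1)]
      by (rule compound_coefficient_symmetric) (use sub[OF ab(1)] sub[OF ab(2)] sym in auto)
  qed
  have Mt: "transpose_mat ?M = ?M"
    using L by (intro eq_matI) (auto simp: Lsym)
  have quad: "fock_coordinates m r f \<bullet> (?M *\<^sub>v fock_coordinates m r f)
      = c * fock_sqnorm m f - second_quantized_form m (\<lambda>i j. B $$ (i, j)) f"
    if f: "f \<in> fock_space m r" for f
  proof -
    let ?v = "fock_coordinates m r f"
    have v: "?v \<in> carrier_vec ?d" by (simp add: fock_coordinates_def)
    have "(c \<cdot>\<^sub>m 1\<^sub>m ?d) *\<^sub>v ?v = c \<cdot>\<^sub>v ?v"
      using v by (intro eq_vecI) auto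
    hence "?M *\<^sub>v ?v = c \<cdot>\<^sub>v ?v - ?L *\<^sub>v ?v"
      using L v by (simp add: minus_mult_distrib_mat_vec[of _ ?d ?d])
    hence "?v \<bullet> (?M *\<^sub>v ?v) = c * (?v \<bullet> ?v) - ?v \<bullet> (?L *\<^sub>v ?v)"
      using L v by (simp add: scalar_prod_minus_distrib[of _ ?d])
    thus ?thesis
      by (simp add: fock_coordinates_sqnorm[OF f] additive_compound_quadratic_form[OF B(1) f])
  qed
  have "psd_mat ?M \<longleftrightarrow> (\<forall>v\<in>carrier_vec ?d. 0 \<le> v \<bullet> (?M *\<^sub>v v))"
    using L Mt by (simp add: psd_mat_def)
  also have "\<dots> \<longleftrightarrow> (\<forall>f\<in>fock_space m r. 0 \<le> fock_coordinates m r f \<bullet> (?M *\<^sub>v fock_coordinates m r f))"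
    by (metis fock_coordinates_surj fock_coordinates_def vec_carrier)
  finally show ?thesis by (simp add: quad)
qed

section \<open>Orthogonal matrices\<close>

lemma orthogonal_groupD:
  assumes "g \<in> orthogonal_group n"
  shows "g \<in> carrier_mat n n" "transpose_mat g \<in> carrier_mat n n"
    "transpose_mat g * g = 1\<^sub>m n" "g * transpose_mat g = 1\<^sub>m n"
  using assms by (auto simp: orthogonal_group_def)

lemma orthogonal_groupI:
  assumes "g \<in> carrier_mat n n" "transpose_mat g * g = 1\<^sub>m n"
  shows "g \<in> orthogonal_group n"
proof -
  have "transpose_mat g \<in> carrier_mat n n" using assms(1) by simp
  hence "g * transpose_mat g = 1\<^sub>m n"
    using assms by (rule mat_mult_left_right_inverse)
  thus ?thesis using assms by (simp add: orthogonal_group_def)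
qed

lemma transpose_orthogonal: "g \<in> orthogonal_group n \<Longrightarrow> transpose_mat g \<in> orthogonal_group n"
  by (auto simp: orthogonal_group_def)

lemma mult_orthogonal:
  assumes g: "g \<in> orthogonal_group n" and h: "h \<in> orthogonal_group n"
  shows "g * h \<in> orthogonal_group n"
proof (rule orthogonal_groupI)
  note g = orthogonal_groupD[OF g] and h = orthogonal_groupD[OF h]
  show "g * h \<in> carrier_mat n n" using g h by simp
  have "transpose_mat (g * h) * (g * h) = transpose_mat h * transpose_mat g * (g * h)"
    using g h by (simp add: transpose_mult[of _ n n _ n])
  also have "\<dots> = transpose_mat h * (transpose_mat g * g) * h"
    using g(1,2) h(1,2) by (simp add: assoc_mult_mat[of _ n n _ n _ n])
  finally show "transpose_mat (g * h) * (g * h) = 1\<^sub>m n" using g h by simp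
qed

lemma orthogonal_inverse_vec:
  assumes "g \<in> orthogonal_group n" "x \<in> carrier_vec n"
  shows "transpose_mat g *\<^sub>v (g *\<^sub>v x) = x" "g *\<^sub>v (transpose_mat g *\<^sub>v x) = x"
proof -
  note g = orthogonal_groupD[OF assms(1)]
  show "transpose_mat g *\<^sub>v (g *\<^sub>v x) = x"
    using assoc_mult_mat_vec[OF g(2,1) assms(2)] assms(2) by (simp add: g(3))
  show "g *\<^sub>v (transpose_mat g *\<^sub>v x) = x"
    using assoc_mult_mat_vec[OF g(1,2) assms(2)] assms(2) by (simp add: g(4))
qed

lemma orthogonal_scalar_prod:
  assumes "g \<in> orthogonal_group n" "x \<in> carrier_vec n" "y \<in> carrier_vec n"
  shows "(g *\<^sub>v x) \<bullet> (g *\<^sub>v y) = x \<bullet> y"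
proof -
  have "(g *\<^sub>v x) \<bullet> (g *\<^sub>v y) = (transpose_mat g *\<^sub>v (g *\<^sub>v x)) \<bullet> y"
    using transpose_vec_mult_scalar[of g n n y "g *\<^sub>v x"] orthogonal_groupD[OF assms(1)] assms by simp
  thus ?thesis using orthogonal_inverse_vec[OF assms(1,2)] by simp
qed

lemma skew_matsD:
  assumes "N \<in> skew_mats n"
  shows "N \<in> carrier_mat n n" "transpose_mat N = - N"
    "\<And>i j. i < n \<Longrightarrow> j < n \<Longrightarrow> N $$ (i, j) = - N $$ (j, i)"
proof -
  show c: "N \<in> carrier_mat n n" "transpose_mat N = - N" using assms by (auto simp: skew_mats_def)
  fix i j assume ij: "i < n" "j < n"
  have "transpose_mat N $$ (j, i) = (- N) $$ (j, i)" using c by simp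
  thus "N $$ (i, j) = - N $$ (j, i)" using c(1) ij by simp
qed

lemma skew_matsI:
  assumes "N \<in> carrier_mat n n" "\<And>i j. i < n \<Longrightarrow> j < n \<Longrightarrow> N $$ (i, j) = - N $$ (j, i)"
  shows "N \<in> skew_mats n"
proof -
  have "transpose_mat N = - N"
  proof (rule eq_matI)
    fix i j assume "i < dim_row (- N)" "j < dim_col (- N)"
    hence ij: "i < n" "j < n" using assms(1) by auto
    have "transpose_mat N $$ (i, j) = N $$ (j, i)" using ij assms(1) by simp
    also have "\<dots> = (- N) $$ (i, j)" using assms(2)[OF ij(2,1)] ij assms(1) by simp
    finally show "transpose_mat N $$ (i, j) = (- N) $$ (i, j)" .
  qed (use assms(1) in auto)
  thus ?thesis using assms(1) by (simp add: skew_mats_def)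
qed

lemma skew_conjugate:
  assumes N: "N \<in> skew_mats n" and g: "g \<in> carrier_mat n n"
  shows "g * N * transpose_mat g \<in> skew_mats n"
proof -
  note N = skew_matsD[OF N]
  have "transpose_mat (g * N * transpose_mat g) = g * (transpose_mat N * transpose_mat g)"
    using N g by (simp add: transpose_mult[of _ n n _ n])
  also have "\<dots> = - (g * N * transpose_mat g)"
    using N(1) g by (simp add: N(2) assoc_mult_mat[of _ n n _ n _ n])
  finally show ?thesis using N g by (simp add: skew_mats_def)
qed

lemma skew_form:
  assumes N: "N \<in> skew_mats n" and x: "x \<in> carrier_vec n" and y: "y \<in> carrier_vec n"
  shows "x \<bullet> (N *\<^sub>v y) = - (y \<bullet> (N *\<^sub>v x))"
proof -
  note N = skew_matsD[OF N]
  have Nx: "N *\<^sub>v x \<in> carrier_vec n" using N x by simp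
  have "x \<bullet> (N *\<^sub>v y) = (transpose_mat N *\<^sub>v x) \<bullet> y"
    using transpose_vec_mult_scalar[of N n n y x] N x y by simp
  also have "transpose_mat N *\<^sub>v x = - (N *\<^sub>v x)"
    using N(1) x by (simp add: N(2))
  also have "(- (N *\<^sub>v x)) \<bullet> y = - (y \<bullet> (N *\<^sub>v x))"
    using uminus_scalar_prod[OF Nx y] comm_scalar_prod[OF Nx y] by simp
  finally show ?thesis .
qed

text \<open>The reflection in the hyperplane orthogonal to \<open>u - v\<close> exchanges the unit vectors \<open>u\<close> and \<open>v\<close>.\<close>

lemma householder_reflection:
  fixes u v :: "real vec"
  assumes u: "u \<in> carrier_vec n" "u \<bullet> u = 1" and v: "v \<in> carrier_vec n" "v \<bullet> v = 1"
  obtains H where "H \<in> orthogonal_group n" "H *\<^sub>v u = v"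
    "\<And>z. z \<in> carrier_vec n \<Longrightarrow> z \<bullet> u = 0 \<Longrightarrow> z \<bullet> v = 0 \<Longrightarrow> H *\<^sub>v z = z"
proof -
  define w where "w = u - v"
  \<comment> \<open>For \<open>u = v\<close> the division by zero gives \<open>c = 0\<close>, and the reflection degenerates to the identity.\<close>
  define c where "c = 2 / (w \<bullet> w)"
  define H where "H = mat n n (\<lambda>(i, j). (if i = j then 1 else 0) - c * w $ i * w $ j)"
  have w: "w \<in> carrier_vec n" using u v by (simp add: w_def)
  have ws: "(\<Sum>k<n. w $ k * w $ k) = w \<bullet> w"
    using w by (simp add: scalar_prod_def atLeast0LessThan)
  have H: "H \<in> carrier_mat n n" by (simp add: H_def)
  have cc: "c * c * (w \<bullet> w) = 2 * c" by (simp add: c_def)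
  have Hz: "H *\<^sub>v z = z - (c * (w \<bullet> z)) \<cdot>\<^sub>v w" if z: "z \<in> carrier_vec n" for z
  proof (rule eq_vecI)
    fix i assume "i < dim_vec (z - (c * (w \<bullet> z)) \<cdot>\<^sub>v w)"
    hence i: "i < n" using w by simp
    have "(H *\<^sub>v z) $ i = (\<Sum>j<n. ((if i = j then 1 else 0) - c * w $ i * w $ j) * z $ j)"
      using i z by (simp add: H_def scalar_prod_def atLeast0LessThan)
    also have "\<dots> = (\<Sum>j<n. (if j = i then z $ i else 0) - c * w $ i * (w $ j * z $ j))"
      by (intro sum.cong refl) (auto simp: algebra_simps)
    also have "\<dots> = z $ i - c * w $ i * (w \<bullet> z)"
      using i z by (simp add: sum_subtractf sum_distrib_left scalar_prod_def atLeast0LessThan)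
    finally show "(H *\<^sub>v z) $ i = (z - (c * (w \<bullet> z)) \<cdot>\<^sub>v w) $ i" using i z w by simp
  qed (use w H z in auto)
  have "transpose_mat H * H = 1\<^sub>m n"
  proof (rule eq_matI)
    fix i j assume "i < dim_row (1\<^sub>m n :: real mat)" "j < dim_col (1\<^sub>m n :: real mat)"
    hence ij: "i < n" "j < n" by auto
    have "(transpose_mat H * H) $$ (i, j)
       = (\<Sum>k<n. ((if k = i then 1 else 0) - c * w $ k * w $ i) * ((if k = j then 1 else 0) - c * w $ k * w $ j))"
      using ij by (simp add: H_def scalar_prod_def atLeast0LessThan)
    also have "\<dots> = (\<Sum>k<n. (if k = i then (if i = j then 1 else 0) - c * w $ i * w $ j else 0)
        - (if k = j then c * w $ i * w $ j else 0) + c * c * (w $ i * w $ j) * (w $ k * w $ k))"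
      by (intro sum.cong refl) (auto simp: algebra_simps)
    also have "\<dots> = (if i = j then 1 else 0) - 2 * c * (w $ i * w $ j) + c * c * (w \<bullet> w) * (w $ i * w $ j)"
      using ij ws by (simp add: sum.distrib sum_subtractf flip: sum_distrib_left)
    also have "\<dots> = (if i = j then 1 else 0)" unfolding cc by simp
    finally show "(transpose_mat H * H) $$ (i, j) = 1\<^sub>m n $$ (i, j)" using ij by simp
  qed (use H in auto)
  hence "H \<in> orthogonal_group n" by (rule orthogonal_groupI[OF H])
  moreover have "H *\<^sub>v u = v"
  proof (cases "w \<bullet> w = 0")
    case True
    hence "\<forall>k\<in>{..<n}. w $ k * w $ k = 0"
      unfolding ws[symmetric] by (subst (asm) sum_nonneg_eq_0_iff) auto
    hence "u = v" using u v by (intro eq_vecI) (auto simp: w_def)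
    moreover have "H *\<^sub>v u = u" unfolding Hz[OF u(1)] using True u w by (auto simp: c_def)
    ultimately show ?thesis by simp
  next
    case False
    have uv: "v \<bullet> u = u \<bullet> v" using u v by (intro comm_scalar_prod)
    have "w \<bullet> u = 1 - u \<bullet> v"
      using u v uv by (simp add: w_def minus_scalar_prod_distrib[of _ n])
    moreover have "w \<bullet> v = u \<bullet> v - 1"
      using u v by (simp add: w_def minus_scalar_prod_distrib[of _ n])
    moreover have "w \<bullet> w = w \<bullet> u - w \<bullet> v"
      using u v w scalar_prod_minus_distrib[of w n u v] by (simp add: w_def)
    ultimately have "c * (w \<bullet> u) = 1" using False by (simp add: c_def field_simps)
    thus ?thesis unfolding Hz[OF u(1)] using u v by (auto simp: w_def)
  qed
  moreover have "H *\<^sub>v z = z" if "z \<in> carrier_vec n" "z \<bullet> u = 0" "z \<bullet> v = 0" for z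
  proof -
    have "z \<bullet> w = 0"
      using that u v unfolding w_def by (simp add: scalar_prod_minus_distrib[of _ n])
    hence "w \<bullet> z = 0" using comm_scalar_prod[OF w that(1)] by simp
    thus ?thesis unfolding Hz[OF that(1)] using that w by auto
  qed
  ultimately show ?thesis using that by blast
qed

text \<open>A first reflection moves the first basis vector to \<open>x\<close>; a second one takes care of \<open>y\<close>. The latter
fixes the first basis vector because the preimage of \<open>y\<close> is orthogonal to it.\<close>

lemma orthogonal_two_columns:
  fixes x y :: "real vec"
  assumes n: "2 \<le> n" and x: "x \<in> carrier_vec n" "x \<bullet> x = 1" and y: "y \<in> carrier_vec n" "y \<bullet> y = 1"
    and xy: "x \<bullet> y = 0"
  obtains g where "g \<in> orthogonal_group n" "g *\<^sub>v unit_vec n 0 = x" "g *\<^sub>v unit_vec n 1 = y"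
proof -
  let ?e = "unit_vec n :: nat \<Rightarrow> real vec"
  have e: "?e 0 \<bullet> ?e 0 = 1" "?e 1 \<bullet> ?e 1 = 1" "?e 0 \<bullet> ?e 1 = 0"
    using n by (simp_all add: scalar_prod_left_unit)
  obtain H1 where H1: "H1 \<in> orthogonal_group n" "H1 *\<^sub>v ?e 0 = x"
    by (rule householder_reflection[of "?e 0" n x]) (use x e in auto)
  define y' where "y' = transpose_mat H1 *\<^sub>v y"
  have y': "y' \<in> carrier_vec n" "H1 *\<^sub>v y' = y"
    using orthogonal_groupD[OF H1(1)] y orthogonal_inverse_vec[OF H1(1) y(1)] by (auto simp: y'_def)
  have "y' \<bullet> y' = 1"
    using orthogonal_scalar_prod[OF H1(1) y'(1) y'(1)] y' y by simp
  moreover have "?e 0 \<bullet> y' = 0"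
    using orthogonal_scalar_prod[OF H1(1) _ y'(1), of "?e 0"] y' H1 xy by simp
  moreover obtain H2 where H2: "H2 \<in> orthogonal_group n" "H2 *\<^sub>v ?e 1 = y'"
      "\<And>z. z \<in> carrier_vec n \<Longrightarrow> z \<bullet> ?e 1 = 0 \<Longrightarrow> z \<bullet> y' = 0 \<Longrightarrow> H2 *\<^sub>v z = z"
    using householder_reflection[OF unit_vec_carrier e(2) y'(1) \<open>y' \<bullet> y' = 1\<close>] by blast
  ultimately have H2_fix: "H2 *\<^sub>v ?e 0 = ?e 0" using e by simp
  note c = orthogonal_groupD(1)[OF H1(1)] orthogonal_groupD(1)[OF H2(1)]
  show ?thesis
  proof (rule that[OF mult_orthogonal[OF H1(1) H2(1)]])
    show "H1 * H2 *\<^sub>v ?e 0 = x" "H1 * H2 *\<^sub>v ?e 1 = y"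
      using H1 H2(2) H2_fix y' c by (simp_all add: assoc_mult_mat_vec[of _ n n _ n])
  qed
qed

section \<open>The normal form of a skew-symmetric matrix\<close>

text \<open>The block diagonal matrix with blocks \<open>(0, \<nu> t; - \<nu> t, 0)\<close>, \<open>t < n div 2\<close>, followed by a zero row and
column if \<open>n\<close> is odd. Indexing the blocks by a function lets the Weyl group act by composition and
by function update.\<close>

definition skew_block_mat :: "nat \<Rightarrow> (nat \<Rightarrow> real) \<Rightarrow> real mat" where
  "skew_block_mat n \<nu> = mat n n (\<lambda>(i, j).
     if even i \<and> j = Suc i then \<nu> (i div 2) else if odd i \<and> i = Suc j then - \<nu> (j div 2) else 0)"

lemma skew_block_mat_carrier [simp]: "skew_block_mat n \<nu> \<in> carrier_mat n n"
  by (simp add: skew_block_mat_def)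

lemma skew_block_mat_skew: "skew_block_mat n \<nu> \<in> skew_mats n"
  by (rule skew_matsI) (auto simp: skew_block_mat_def)

lemma skew_block_mat_Suc_Suc:
  "skew_block_mat (Suc (Suc n)) \<nu> = four_block_mat (skew_block_mat 2 \<nu>) (0\<^sub>m 2 n) (0\<^sub>m n 2)
     (skew_block_mat n (\<lambda>t. \<nu> (Suc t)))" (is "?L = ?R")
proof (rule eq_matI)
  fix i j assume "i < dim_row ?R" "j < dim_col ?R"
  hence ij: "i < Suc (Suc n)" "j < Suc (Suc n)" by (auto simp: skew_block_mat_def)
  have split: "i = 0 \<or> i = 1 \<or> (\<exists>i'. i = Suc (Suc i'))" for i :: nat
    by (metis One_nat_def not0_implies_Suc)
  show "?L $$ (i, j) = ?R $$ (i, j)"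
    using ij split[of i] split[of j]
    by (elim disjE exE) (simp_all add: skew_block_mat_def, auto)
qed (auto simp: skew_block_mat_def)

lemma det_2x2:
  assumes "A \<in> carrier_mat 2 2"
  shows "det A = A $$ (0, 0) * A $$ (1, 1) - A $$ (1, 0) * A $$ (0, 1)"
proof -
  have "det A = (\<Sum>i<2. A $$ (i, 0) * cofactor A i 0)"
    by (rule laplace_expansion_column) (use assms in auto)
  also have "\<dots> = A $$ (0, 0) * cofactor A 0 0 + A $$ (1, 0) * cofactor A 1 0"
    by (simp add: numeral_2_eq_2)
  also have "cofactor A 0 0 = A $$ (1, 1)"
    using assms mat_delete_carrier[OF assms, of 0 0]
    by (simp add: cofactor_def det_single) (simp add: mat_delete_def)
  also have "cofactor A 1 0 = - A $$ (0, 1)"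
    using assms mat_delete_carrier[OF assms, of 1 0]
    by (simp add: cofactor_def det_single) (simp add: mat_delete_def)
  finally show ?thesis by simp
qed

lemma char_poly_skew_2x2:
  "char_poly (map_mat complex_of_real (skew_block_mat 2 \<nu>))
     = [:- (\<i> * complex_of_real (\<nu> 0)), 1:] * [:\<i> * complex_of_real (\<nu> 0), 1:]"
proof -
  let ?C = "map_mat complex_of_real (skew_block_mat 2 \<nu>)"
  have C: "?C \<in> carrier_mat 2 2" by simp
  have "char_poly_matrix ?C \<in> carrier_mat 2 2" using C by simp
  thus ?thesis
    unfolding char_poly_def
    by (subst det_2x2) (auto simp: char_poly_matrix_def skew_block_mat_def mult.assoc mult.left_commute)
qed

lemma proots_skew_block_mat:
  "proots (char_poly (map_mat complex_of_real (skew_block_mat n \<nu>))) =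
     mset (map (\<lambda>t. \<i> * complex_of_real (\<nu> t)) [0..<n div 2])
     + mset (map (\<lambda>t. - (\<i> * complex_of_real (\<nu> t))) [0..<n div 2])
     + (if odd n then {#0#} else {#})"
proof (induction n arbitrary: \<nu> rule: induct_nat_012)
  case 0
  have "map_mat complex_of_real (skew_block_mat 0 \<nu>) \<in> carrier_mat 0 0" by simp
  hence "char_poly (map_mat complex_of_real (skew_block_mat 0 \<nu>)) = 1"
    unfolding char_poly_def by (intro det_dim_zero) simp
  thus ?case by simp
next
  case 1
  let ?C = "map_mat complex_of_real (skew_block_mat 1 \<nu>)"
  have "char_poly_matrix ?C \<in> carrier_mat 1 1" by simp
  hence "char_poly ?C = [:0, 1:]"
    unfolding char_poly_def by (simp add: det_single) (simp add: char_poly_matrix_def skew_block_mat_def)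
  thus ?case using proots_linear_factor[of "0::complex"] by simp
next
  case (ge2 n)
  let ?B = "map_mat complex_of_real (skew_block_mat 2 \<nu>)"
  let ?D = "map_mat complex_of_real (skew_block_mat n (\<lambda>t. \<nu> (Suc t)))"
  have B: "?B \<in> carrier_mat 2 2" and D: "?D \<in> carrier_mat n n" by auto
  have A: "map_mat complex_of_real (skew_block_mat (Suc (Suc n)) \<nu>)
      = four_block_mat ?B (0\<^sub>m 2 n) (0\<^sub>m n 2) ?D"
    unfolding skew_block_mat_Suc_Suc
    by (subst map_four_block_mat[of _ 2 2 _ n _ n]) (auto intro!: arg_cong2[where f = "\<lambda>Z Z'. four_block_mat _ Z Z' _"] eq_matI)
  have "char_poly (map_mat complex_of_real (skew_block_mat (Suc (Suc n)) \<nu>)) = char_poly ?B * char_poly ?D"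
    by (rule char_poly_0_block[OF A]) (use char_poly_factorized[OF B] char_poly_factorized[OF D] in auto)
  moreover have "char_poly ?B \<noteq> 0" "char_poly ?D \<noteq> 0"
    using degree_monic_char_poly[OF B] degree_monic_char_poly[OF D] by auto
  ultimately have "proots (char_poly (map_mat complex_of_real (skew_block_mat (Suc (Suc n)) \<nu>)))
      = proots (char_poly ?B) + proots (char_poly ?D)"
    by (simp add: proots_mult)
  also have "proots (char_poly ?B) = {#\<i> * complex_of_real (\<nu> 0), - (\<i> * complex_of_real (\<nu> 0))#}"
    unfolding char_poly_skew_2x2 by (subst proots_mult) (auto simp: proots_linear_factor)
  finally show ?case
    unfolding ge2.IH(1)
    by (simp add: upt_conv_Cons map_Suc_upt[symmetric] comp_def del: upt_Suc)
qed

lemma real_vec_sqnorm_pos: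
  fixes a :: "real vec"
  assumes "a \<in> carrier_vec n" "a \<noteq> 0\<^sub>v n"
  shows "0 < a \<bullet> a"
proof -
  obtain i where i: "i < n" "a $ i \<noteq> 0" using assms by (metis carrier_vecD eq_vecI index_zero_vec)
  have "0 < a $ i * a $ i" using i(2) by (metis not_real_square_gt_zero)
  also have "\<dots> \<le> (\<Sum>i<n. a $ i * a $ i)"
    by (rule member_le_sum) (use i in auto)
  also have "\<dots> = a \<bullet> a" using assms by (simp add: scalar_prod_def atLeast0LessThan)
  finally show ?thesis .
qed

text \<open>The real and imaginary parts of a complex eigenvector. Its eigenvalue is imaginary, and
exchanging the two parts changes the sign of the eigenvalue, so \<open>t\<close> may be taken nonnegative.\<close>

lemma skew_complex_eigenvector:
  assumes N: "N \<in> skew_mats n" and n: "0 < n"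
  obtains t a b where "0 \<le> (t::real)" "a \<in> carrier_vec n" "b \<in> carrier_vec n"
    "a \<noteq> 0\<^sub>v n \<or> b \<noteq> 0\<^sub>v n" "N *\<^sub>v a = (- t) \<cdot>\<^sub>v b" "N *\<^sub>v b = t \<cdot>\<^sub>v a"
proof -
  let ?C = "map_mat complex_of_real N"
  note Nc = skew_matsD(1)[OF N]
  have C: "?C \<in> carrier_mat n n" using Nc by simp
  obtain z where "z \<in> spectrum ?C" using spectrum_non_empty[OF C n] by auto
  hence ev: "eigenvalue ?C z" by (simp add: spectrum_def)
  hence "poly (char_poly ?C) z = 0" using eigenvalue_root_char_poly[OF C] by simp
  hence z: "Re z = 0" by (rule skew_eigenvalue_imaginary[OF N])
  obtain v where v: "v \<in> carrier_vec n" "v \<noteq> 0\<^sub>v n" "?C *\<^sub>v v = z \<cdot>\<^sub>v v"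
    using ev C by (auto simp: eigenvalue_def eigenvector_def)
  define a where "a = map_vec Re v"
  define b where "b = map_vec Im v"
  have ab: "a \<in> carrier_vec n" "b \<in> carrier_vec n" using v by (auto simp: a_def b_def)
  have row: "(\<Sum>j<n. complex_of_real (N $$ (i, j)) * v $ j) = z * v $ i" if "i < n" for i
  proof -
    have "(?C *\<^sub>v v) $ i = (z \<cdot>\<^sub>v v) $ i" using v(3) by simp
    thus ?thesis using that v(1) Nc by (simp add: scalar_prod_def atLeast0LessThan)
  qed
  have Na: "N *\<^sub>v a = (- Im z) \<cdot>\<^sub>v b"
  proof (rule eq_vecI)
    fix i assume "i < dim_vec ((- Im z) \<cdot>\<^sub>v b)"
    hence i: "i < n" using ab by simp
    have "(N *\<^sub>v a) $ i = Re (\<Sum>j<n. complex_of_real (N $$ (i, j)) * v $ j)"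
      using i Nc v by (simp add: a_def scalar_prod_def atLeast0LessThan)
    also have "\<dots> = ((- Im z) \<cdot>\<^sub>v b) $ i" unfolding row[OF i] using i v z by (simp add: b_def)
    finally show "(N *\<^sub>v a) $ i = ((- Im z) \<cdot>\<^sub>v b) $ i" .
  qed (use Nc ab in auto)
  have Nb: "N *\<^sub>v b = Im z \<cdot>\<^sub>v a"
  proof (rule eq_vecI)
    fix i assume "i < dim_vec (Im z \<cdot>\<^sub>v a)"
    hence i: "i < n" using ab by simp
    have "(N *\<^sub>v b) $ i = Im (\<Sum>j<n. complex_of_real (N $$ (i, j)) * v $ j)"
      using i Nc v by (simp add: b_def scalar_prod_def atLeast0LessThan)
    also have "\<dots> = (Im z \<cdot>\<^sub>v a) $ i" unfolding row[OF i] using i v z by (simp add: a_def)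
    finally show "(N *\<^sub>v b) $ i = (Im z \<cdot>\<^sub>v a) $ i" .
  qed (use Nc ab in auto)
  have nz: "a \<noteq> 0\<^sub>v n \<or> b \<noteq> 0\<^sub>v n"
  proof (rule ccontr)
    assume "\<not> (a \<noteq> 0\<^sub>v n \<or> b \<noteq> 0\<^sub>v n)"
    hence z: "a = 0\<^sub>v n" "b = 0\<^sub>v n" by auto
    have "v = 0\<^sub>v n"
    proof (rule eq_vecI)
      fix i assume "i < dim_vec (0\<^sub>v n :: complex vec)"
      hence i: "i < n" by simp
      have "a $ i = 0" "b $ i = 0" using z i by auto
      thus "v $ i = 0\<^sub>v n $ i" using i v(1) by (simp add: a_def b_def complex_eq_iff)
    qed (use v in simp)
    thus False using v(2) by simp
  qed
  show ?thesis
  proof (cases "0 \<le> Im z")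
    case True
    thus ?thesis using that[of "Im z" a b] ab nz Na Nb by blast
  next
    case False
    thus ?thesis using that[of "- Im z" b a] ab nz Na Nb by auto
  qed
qed

definition skew_pair :: "nat \<Rightarrow> real mat \<Rightarrow> real \<Rightarrow> real vec \<Rightarrow> real vec \<Rightarrow> bool" where
  "skew_pair n N \<mu> x y \<longleftrightarrow> 0 \<le> \<mu> \<and> x \<in> carrier_vec n \<and> y \<in> carrier_vec n \<and>
     x \<bullet> x = 1 \<and> y \<bullet> y = 1 \<and> x \<bullet> y = 0 \<and> N *\<^sub>v x = (- \<mu>) \<cdot>\<^sub>v y \<and> N *\<^sub>v y = \<mu> \<cdot>\<^sub>v x"

lemma real_vec_normalize:
  fixes a :: "real vec"
  assumes "a \<in> carrier_vec n" "a \<noteq> 0\<^sub>v n"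
  defines "c \<equiv> 1 / sqrt (a \<bullet> a)"
  shows "(c \<cdot>\<^sub>v a) \<bullet> (c \<cdot>\<^sub>v a) = 1"
proof -
  have "(c \<cdot>\<^sub>v a) \<bullet> (c \<cdot>\<^sub>v a) = (c * c) * (a \<bullet> a)"
    using assms(1) by (simp add: smult_scalar_prod_distrib[of _ n] scalar_prod_smult_distrib[of _ n])
  thus ?thesis using real_vec_sqnorm_pos[OF assms(1,2)] by (simp add: c_def)
qed

text \<open>For a nonzero eigenvalue, skew-symmetry forces the real and imaginary parts of the eigenvector to be
orthogonal and of equal length, so one scalar normalizes both.\<close>

lemma skew_kernel_or_pair:
  assumes N: "N \<in> skew_mats n" and n: "0 < n"
  shows "(\<exists>x\<in>carrier_vec n. x \<bullet> x = 1 \<and> N *\<^sub>v x = 0\<^sub>v n) \<or> (\<exists>\<mu> x y. skew_pair n N \<mu> x y)"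
proof -
  note Nc = skew_matsD(1)[OF N]
  obtain t a b where t: "0 \<le> t" and ab: "a \<in> carrier_vec n" "b \<in> carrier_vec n"
    and nz: "a \<noteq> 0\<^sub>v n \<or> b \<noteq> 0\<^sub>v n" and Na: "N *\<^sub>v a = (- t) \<cdot>\<^sub>v b" and Nb: "N *\<^sub>v b = t \<cdot>\<^sub>v a"
    by (rule skew_complex_eigenvector[OF N n])
  show ?thesis
  proof (cases "t = 0")
    case True
    have "0 \<cdot>\<^sub>v a = 0\<^sub>v n" "0 \<cdot>\<^sub>v b = 0\<^sub>v n" using ab by (auto intro!: eq_vecI)
    hence N0: "N *\<^sub>v a = 0\<^sub>v n" "N *\<^sub>v b = 0\<^sub>v n" using Na Nb True by simp_all
    obtain w where w: "w \<in> carrier_vec n" "w \<noteq> 0\<^sub>v n" "N *\<^sub>v w = 0\<^sub>v n"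
    proof (cases "a = 0\<^sub>v n")
      case False
      thus ?thesis using that[of a] ab N0 by auto
    next
      case True
      thus ?thesis using that[of b] nz ab N0 by auto
    qed
    let ?x = "(1 / sqrt (w \<bullet> w)) \<cdot>\<^sub>v w"
    have "N *\<^sub>v ?x = 0\<^sub>v n" using mult_mat_vec[OF Nc w(1)] w by auto
    thus ?thesis using real_vec_normalize[OF w(1,2)] w(1) by (intro disjI1 bexI[of _ ?x]) auto
  next
    case False
    hence t: "0 < t" using t by simp
    have ba: "b \<bullet> a = a \<bullet> b" using ab by (intro comm_scalar_prod)
    have "a \<bullet> (N *\<^sub>v a) = 0" using skew_form[OF N ab(1) ab(1)] by simp
    hence orth: "a \<bullet> b = 0" using ab t by (simp add: Na)
    have "a \<bullet> (N *\<^sub>v b) = - (b \<bullet> (N *\<^sub>v a))" by (rule skew_form[OF N ab])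
    hence eq: "a \<bullet> a = b \<bullet> b" using ab t by (simp add: Na Nb)
    have "a \<noteq> 0\<^sub>v n \<and> b \<noteq> 0\<^sub>v n"
      using nz eq real_vec_sqnorm_pos[OF ab(1)] real_vec_sqnorm_pos[OF ab(2)] by auto
    note u = real_vec_normalize[OF ab(1) conjunct1[OF this]] real_vec_normalize[OF ab(2) conjunct2[OF this]]
    let ?c = "1 / sqrt (a \<bullet> a)"
    have "N *\<^sub>v (?c \<cdot>\<^sub>v a) = (- t) \<cdot>\<^sub>v (?c \<cdot>\<^sub>v b)"
      using ab by (simp add: mult_mat_vec[OF Nc] Na smult_smult_assoc mult.commute)
    moreover have "N *\<^sub>v (?c \<cdot>\<^sub>v b) = t \<cdot>\<^sub>v (?c \<cdot>\<^sub>v a)"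
      using ab by (simp add: mult_mat_vec[OF Nc] Nb smult_smult_assoc mult.commute)
    moreover have "(?c \<cdot>\<^sub>v a) \<bullet> (?c \<cdot>\<^sub>v b) = 0" using ab orth by simp
    ultimately have "skew_pair n N t (?c \<cdot>\<^sub>v a) (?c \<cdot>\<^sub>v b)"
      using ab t u eq by (simp add: skew_pair_def)
    thus ?thesis by blast
  qed
qed

text \<open>If the eigenvector found first is a kernel vector \<open>x\<close>, the orthogonal complement of \<open>x\<close> is invariant. A kernel vector
of the restriction to it completes \<open>x\<close> to a pair with \<open>\<mu> = 0\<close>, and a pair of the restriction is a
pair of \<open>N\<close>.\<close>

lemma skew_pair_exists:
  assumes N: "N \<in> skew_mats n" and n: "2 \<le> n"
  shows "\<exists>\<mu> x y. skew_pair n N \<mu> x y"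
proof (cases "\<exists>\<mu> x y. skew_pair n N \<mu> x y")
  case False
  then obtain x where x: "x \<in> carrier_vec n" "x \<bullet> x = 1" "N *\<^sub>v x = 0\<^sub>v n"
    using skew_kernel_or_pair[OF N] n by auto
  obtain p where p: "n = Suc p" "0 < p" using n by (cases n) auto
  let ?e = "unit_vec n 0 :: real vec"
  have e: "?e \<bullet> ?e = 1" using n by (simp add: scalar_prod_left_unit)
  obtain H where H: "H \<in> orthogonal_group n" "H *\<^sub>v ?e = x"
    using householder_reflection[OF unit_vec_carrier e x(1,2)] by blast
  note Hc = orthogonal_groupD[OF H(1)] and Nc = skew_matsD(1)[OF N]
  define M where "M = transpose_mat H * N * H"
  have Mskew: "M \<in> skew_mats n"
    using skew_conjugate[OF N Hc(2)] by (simp add: M_def)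
  note M = skew_matsD[OF Mskew]
  have NH: "N *\<^sub>v (H *\<^sub>v z) = H *\<^sub>v (M *\<^sub>v z)" if z: "z \<in> carrier_vec n" for z
  proof -
    have "M *\<^sub>v z = transpose_mat H *\<^sub>v (N *\<^sub>v (H *\<^sub>v z))"
      using Hc Nc z by (simp add: M_def assoc_mult_mat_vec[of _ n n _ n])
    moreover have "N *\<^sub>v (H *\<^sub>v z) \<in> carrier_vec n" using Hc Nc z by simp
    ultimately show ?thesis using orthogonal_inverse_vec(2)[OF H(1)] by simp
  qed
  have col0: "M $$ (i, 0) = 0" if i: "i < n" for i
  proof -
    have "M *\<^sub>v ?e = transpose_mat H *\<^sub>v (N *\<^sub>v x)"
      using Hc Nc H(2) by (simp add: M_def assoc_mult_mat_vec[of _ n n _ n])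
    also have "\<dots> = 0\<^sub>v n" unfolding x(3) using Hc by auto
    finally have "(M *\<^sub>v ?e) $ i = 0" using i by simp
    thus ?thesis using i M(1) n by (simp add: scalar_prod_right_unit)
  qed
  have row0: "M $$ (0, i) = 0" if i: "i < n" for i
    using M(3)[of 0 i] col0[OF i] i n by simp
  \<comment> \<open>In the basis given by \<open>H\<close> the first row and column vanish; \<open>N1\<close> is the restriction to the complement of \<open>x\<close>.\<close>
  define N1 where "N1 = mat p p (\<lambda>(i, j). M $$ (Suc i, Suc j))"
  have N1c: "N1 \<in> carrier_mat p p" by (simp add: N1_def)
  have N1: "N1 \<in> skew_mats p"
  proof (rule skew_matsI[OF N1c])
    fix i j assume "i < p" "j < p"
    thus "N1 $$ (i, j) = - N1 $$ (j, i)" using M(3)[of "Suc i" "Suc j"] p by (simp add: N1_def)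
  qed
  have lift: "N *\<^sub>v (H *\<^sub>v vCons 0 w) = H *\<^sub>v vCons 0 (N1 *\<^sub>v w)" if w: "w \<in> carrier_vec p" for w
  proof -
    have "M *\<^sub>v vCons 0 w = vCons 0 (N1 *\<^sub>v w)"
    proof (rule eq_vecI)
      fix i assume "i < dim_vec (vCons 0 (N1 *\<^sub>v w))"
      hence i: "i < n" using p N1c by simp
      have "(M *\<^sub>v vCons 0 w) $ i = (\<Sum>j<Suc p. M $$ (i, j) * vCons 0 w $ j)"
        using i M(1) w p by (simp add: scalar_prod_def atLeast0LessThan)
      also have "\<dots> = (\<Sum>j<p. M $$ (i, Suc j) * w $ j)"
        by (simp add: sum.lessThan_Suc_shift del: sum.lessThan_Suc)
      also have "\<dots> = vCons 0 (N1 *\<^sub>v w) $ i"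
      proof (cases i)
        case 0
        thus ?thesis using row0 p by simp
      next
        case (Suc i')
        thus ?thesis using i p w by (simp add: N1_def scalar_prod_def atLeast0LessThan)
      qed
      finally show "(M *\<^sub>v vCons 0 w) $ i = vCons 0 (N1 *\<^sub>v w) $ i" .
    qed (use M N1c p in auto)
    thus ?thesis using NH[of "vCons 0 w"] w p by simp
  qed
  have carr: "vCons 0 w \<in> carrier_vec n" if "w \<in> carrier_vec p" for w :: "real vec"
    using that p by simp
  have inner: "(H *\<^sub>v vCons 0 w) \<bullet> (H *\<^sub>v vCons 0 w') = w \<bullet> w'"
    if "w \<in> carrier_vec p" "w' \<in> carrier_vec p" for w w'
    using orthogonal_scalar_prod[OF H(1) carr[OF that(1)] carr[OF that(2)]] by simp
  have "skew_pair n N 0 x (H *\<^sub>v vCons 0 y)" if y: "y \<in> carrier_vec p" "y \<bullet> y = 1" "N1 *\<^sub>v y = 0\<^sub>v p" for y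
  proof -
    have Hy: "H *\<^sub>v vCons 0 y \<in> carrier_vec n" using Hc carr[OF y(1)] by simp
    have "x \<bullet> (H *\<^sub>v vCons 0 y) = ?e \<bullet> vCons 0 y"
      using orthogonal_scalar_prod[OF H(1) unit_vec_carrier carr[OF y(1)], of 0] H(2) by simp
    also have "\<dots> = 0" using carr[OF y(1)] n by (simp add: scalar_prod_left_unit[of _ n])
    finally have xy: "x \<bullet> (H *\<^sub>v vCons 0 y) = 0" .
    have "vCons 0 (0\<^sub>v p) = (0\<^sub>v n :: real vec)"
      unfolding p by (rule eq_vecI) (auto simp: less_Suc_eq_0_disj)
    hence "N *\<^sub>v (H *\<^sub>v vCons 0 y) = 0\<^sub>v n"
      unfolding lift[OF y(1)] y(3) using Hc by auto
    moreover have "0 \<cdot>\<^sub>v w = 0\<^sub>v n" if "w \<in> carrier_vec n" for w :: "real vec"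
      using that by (auto intro!: eq_vecI)
    note this[OF Hy] this[OF x(1)]
    ultimately show ?thesis
      unfolding skew_pair_def using x y inner[OF y(1) y(1)] xy Hy by simp
  qed
  moreover have "skew_pair n N \<mu> (H *\<^sub>v vCons 0 y) (H *\<^sub>v vCons 0 y')" if pr: "skew_pair p N1 \<mu> y y'" for \<mu> y y'
  proof -
    have y: "y \<in> carrier_vec p" "y' \<in> carrier_vec p" using pr by (auto simp: skew_pair_def)
    have sm: "H *\<^sub>v vCons 0 (k \<cdot>\<^sub>v w) = k \<cdot>\<^sub>v (H *\<^sub>v vCons 0 w)" if w: "w \<in> carrier_vec p" for k w
    proof -
      have "vCons 0 (k \<cdot>\<^sub>v w) = k \<cdot>\<^sub>v vCons 0 w"
        by (rule eq_vecI) (auto simp: less_Suc_eq_0_disj)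
      thus ?thesis using mult_mat_vec[OF Hc(1) carr[OF w]] by simp
    qed
    show ?thesis
      using pr lift[OF y(1)] lift[OF y(2)] sm[OF y(1)] sm[OF y(2)] inner y Hc carr[OF y(1)] carr[OF y(2)]
      by (simp add: skew_pair_def)
  qed
  ultimately show ?thesis using skew_kernel_or_pair[OF N1 p(2)] by blast
qed

text \<open>Induction in steps of two: an orthogonal change of basis that starts with a pair \<open>x\<close>, \<open>y\<close> splits off a
\<open>2\<times>2\<close> block, and skew-symmetry makes the off-diagonal blocks vanish.\<close>

lemma skew_canonical_form:
  assumes "N \<in> skew_mats n"
  shows "\<exists>g\<in>orthogonal_group n. \<exists>l. length l = n div 2 \<and> (\<forall>x\<in>set l. 0 \<le> x) \<and>
     transpose_mat g * N * g = skew_block_mat n ((!) l)"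
  using assms
proof (induction n arbitrary: N rule: induct_nat_012)
  case 0
  have "(1\<^sub>m 0 :: real mat) \<in> orthogonal_group 0" by (rule orthogonal_groupI) auto
  moreover have "transpose_mat (1\<^sub>m 0) * N * 1\<^sub>m 0 = skew_block_mat 0 ((!) [])"
    using skew_matsD(1)[OF 0] by (intro eq_matI) (auto simp: skew_block_mat_def)
  ultimately show ?case by fastforce
next
  case 1
  have N: "N \<in> carrier_mat 1 1" "N $$ (0, 0) = 0"
    using skew_matsD(1)[OF 1] skew_matsD(3)[OF 1, of 0 0] by auto
  have "(1\<^sub>m 1 :: real mat) \<in> orthogonal_group 1" by (rule orthogonal_groupI) auto
  moreover have "transpose_mat (1\<^sub>m 1) * N * 1\<^sub>m 1 = skew_block_mat 1 ((!) [])"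
    using N by (intro eq_matI) (auto simp: skew_block_mat_def)
  ultimately show ?case by (intro bexI[of _ "1\<^sub>m 1"] exI[of _ "[]"]) auto
next
  case (ge2 p)
  let ?n = "Suc (Suc p)"
  note N = ge2.prems and Nc = skew_matsD(1)[OF ge2.prems]
  obtain \<mu> x y where pr: "skew_pair ?n N \<mu> x y" using skew_pair_exists[OF N] by auto
  hence pr': "x \<in> carrier_vec ?n" "x \<bullet> x = 1" "y \<in> carrier_vec ?n" "y \<bullet> y = 1" "x \<bullet> y = 0"
    "0 \<le> \<mu>" "N *\<^sub>v x = (- \<mu>) \<cdot>\<^sub>v y" "N *\<^sub>v y = \<mu> \<cdot>\<^sub>v x" by (auto simp: skew_pair_def)
  obtain g where g: "g \<in> orthogonal_group ?n" "g *\<^sub>v unit_vec ?n 0 = x" "g *\<^sub>v unit_vec ?n 1 = y"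
    by (rule orthogonal_two_columns[OF _ pr'(1-5)]) auto
  note gc = orthogonal_groupD[OF g(1)]
  define M where "M = transpose_mat g * N * g"
  have Mskew: "M \<in> skew_mats ?n" using skew_conjugate[OF N gc(2)] by (simp add: M_def)
  note M = skew_matsD[OF Mskew]
  have Mcol: "M $$ (i, j) = (transpose_mat g *\<^sub>v (N *\<^sub>v (g *\<^sub>v unit_vec ?n j))) $ i" if ij: "i < ?n" "j < ?n" for i j
  proof -
    have "M *\<^sub>v unit_vec ?n j = transpose_mat g *\<^sub>v (N *\<^sub>v (g *\<^sub>v unit_vec ?n j))"
      using gc Nc by (simp add: M_def assoc_mult_mat_vec[of _ ?n ?n _ ?n])
    moreover have "(M *\<^sub>v unit_vec ?n j) $ i = M $$ (i, j)"
      using ij M(1) by (simp add: scalar_prod_right_unit)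
    ultimately show ?thesis by simp
  qed
  have columns: "transpose_mat g *\<^sub>v x = unit_vec ?n 0" "transpose_mat g *\<^sub>v y = unit_vec ?n 1"
    using orthogonal_inverse_vec(1)[OF g(1)] g(2,3) by (metis unit_vec_carrier)+
  have M0: "M $$ (i, 0) = (if i = 1 then - \<mu> else 0)" if i: "i < ?n" for i
    using Mcol[OF i, of 0] g(2) pr' columns i by (simp add: mult_mat_vec[OF gc(2)])
  have M1: "M $$ (i, 1) = (if i = 0 then \<mu> else 0)" if i: "i < ?n" for i
    using Mcol[OF i, of 1] g(3) pr' columns i by (simp add: mult_mat_vec[OF gc(2)])
  define N1 where "N1 = mat p p (\<lambda>(i, j). M $$ (Suc (Suc i), Suc (Suc j)))"
  have N1c: "N1 \<in> carrier_mat p p" by (simp add: N1_def)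
  have N1: "N1 \<in> skew_mats p"
  proof (rule skew_matsI[OF N1c])
    fix i j assume "i < p" "j < p"
    thus "N1 $$ (i, j) = - N1 $$ (j, i)" using M(3)[of "Suc (Suc i)" "Suc (Suc j)"] by (simp add: N1_def)
  qed
  have Mblock: "M = four_block_mat (skew_block_mat 2 (\<lambda>_. \<mu>)) (0\<^sub>m 2 p) (0\<^sub>m p 2) N1" (is "_ = ?R")
  proof (rule eq_matI)
    fix i j assume "i < dim_row ?R" "j < dim_col ?R"
    hence ij: "i < ?n" "j < ?n" by (auto simp: skew_block_mat_def N1_def)
    have split: "i = 0 \<or> i = 1 \<or> (\<exists>i'. i = Suc (Suc i'))" for i :: nat
      by (metis One_nat_def not0_implies_Suc)
    have "M $$ (0, j) = (if j = 1 then \<mu> else 0)" "M $$ (1, j) = (if j = 0 then - \<mu> else 0)"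
      by (subst M(3), use ij in simp_all, simp add: M0 M1[unfolded One_nat_def])+
    thus "M $$ (i, j) = ?R $$ (i, j)"
      using ij split[of i] split[of j] M0[OF ij(1)] M1[OF ij(1)]
      by (elim disjE exE) (simp_all add: skew_block_mat_def N1_def)
  qed (use M in \<open>auto simp: skew_block_mat_def N1_def\<close>)
  obtain h l where h: "h \<in> orthogonal_group p" and l: "length l = p div 2" "\<forall>x\<in>set l. 0 \<le> x"
    and hl: "transpose_mat h * N1 * h = skew_block_mat p ((!) l)"
    using ge2.IH(1)[OF N1] by blast
  note hc = orthogonal_groupD[OF h]
  define F where "F = four_block_mat (1\<^sub>m 2) (0\<^sub>m 2 p) (0\<^sub>m p 2) h"
  have Fc: "F \<in> carrier_mat ?n ?n"
    using four_block_carrier_mat[of "1\<^sub>m 2" 2 2 h p p] hc by (simp add: F_def)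
  have Ft: "transpose_mat F = four_block_mat (1\<^sub>m 2) (0\<^sub>m 2 p) (0\<^sub>m p 2) (transpose_mat h)"
    unfolding F_def using hc by (subst transpose_four_block_mat[of _ 2 2 _ p _ p]) auto
  have J: "skew_block_mat 2 (\<lambda>_. \<mu>) \<in> carrier_mat 2 2" by simp
  have mult: "four_block_mat A (0\<^sub>m 2 p) (0\<^sub>m p 2) D * four_block_mat A' (0\<^sub>m 2 p) (0\<^sub>m p 2) D'
      = four_block_mat (A * A') (0\<^sub>m 2 p) (0\<^sub>m p 2) (D * D')"
    if "A \<in> carrier_mat 2 2" "A' \<in> carrier_mat 2 2" "D \<in> carrier_mat p p" "D' \<in> carrier_mat p p"
    for A A' D D' :: "real mat"
    using that by (subst mult_four_block_mat[of _ 2 2 _ p _ p _ _ 2 _ p]) auto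
  have "transpose_mat F * F = 1\<^sub>m ?n"
    unfolding Ft unfolding F_def using hc by (subst mult) auto
  hence F: "F \<in> orthogonal_group ?n" by (rule orthogonal_groupI[OF Fc])
  have "transpose_mat F * M
      = four_block_mat (skew_block_mat 2 (\<lambda>_. \<mu>)) (0\<^sub>m 2 p) (0\<^sub>m p 2) (transpose_mat h * N1)"
    unfolding Ft Mblock using hc N1c J by (subst mult) (auto simp: left_mult_one_mat[OF J])
  hence "transpose_mat F * M * F
      = four_block_mat (skew_block_mat 2 (\<lambda>_. \<mu>)) (0\<^sub>m 2 p) (0\<^sub>m p 2) (transpose_mat h * N1 * h)"
    unfolding F_def using hc N1c J by (simp only:) (subst mult, auto simp: right_mult_one_mat[OF J])
  also have "\<dots> = skew_block_mat ?n ((!) (\<mu> # l))"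
    unfolding hl skew_block_mat_Suc_Suc by (auto simp: skew_block_mat_def intro!: arg_cong2[where f = "\<lambda>A B. four_block_mat A _ _ B"] eq_matI)
  finally have "transpose_mat F * M * F = skew_block_mat ?n ((!) (\<mu> # l))" .
  moreover have "transpose_mat (g * F) * N * (g * F) = transpose_mat F * M * F"
    using gc Fc Nc by (simp add: M_def transpose_mult[of _ ?n ?n _ ?n] assoc_mult_mat[of _ ?n ?n _ ?n _ ?n])
  moreover have "length (\<mu> # l) = ?n div 2" "\<forall>x\<in>set (\<mu> # l). 0 \<le> x" using l pr' by auto
  ultimately show ?case using mult_orthogonal[OF g(1) F] by (metis (no_types, lifting))
qed

lemma skew_block_mat_cong:
  assumes "\<And>t. t < n div 2 \<Longrightarrow> \<nu> t = \<nu>' t"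
  shows "skew_block_mat n \<nu> = skew_block_mat n \<nu>'"
proof (rule eq_matI)
  fix i j assume "i < dim_row (skew_block_mat n \<nu>')" "j < dim_col (skew_block_mat n \<nu>')"
  hence ij: "i < n" "j < n" by (auto simp: skew_block_mat_def)
  have "i div 2 < n div 2" if "even i" "j = Suc i" using that ij by presburger
  moreover have "j div 2 < n div 2" if "odd i" "i = Suc j" using that ij by presburger
  ultimately show "skew_block_mat n \<nu> $$ (i, j) = skew_block_mat n \<nu>' $$ (i, j)"
    using assms ij by (auto simp: skew_block_mat_def)
qed (auto simp: skew_block_mat_def)

lemma signed_permutation_conjugate:
  fixes M :: "real mat"
  assumes \<pi>: "\<pi> permutes {..<n}" and d: "\<And>i. d i * d i = 1" and M: "M \<in> carrier_mat n n"
  shows "\<exists>P\<in>orthogonal_group n. P * M * transpose_mat P = mat n n (\<lambda>(i, j). d i * d j * M $$ (\<pi> i, \<pi> j))"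
proof
  define P where "P = mat n n (\<lambda>(i, j). if j = \<pi> i then d i else 0)"
  have P: "P \<in> carrier_mat n n" by (simp add: P_def)
  have \<pi>n: "\<pi> i < n" if "i < n" for i using permutes_in_image[OF \<pi>, of i] that by simp
  have \<pi>inj: "\<pi> i = \<pi> j \<longleftrightarrow> i = j" for i j using permutes_inj[OF \<pi>] by (auto dest: injD)
  have PM: "(P * X) $$ (i, j) = d i * X $$ (\<pi> i, j)" if "X \<in> carrier_mat n n" "i < n" "j < n" for X i j
  proof -
    have "(P * X) $$ (i, j) = (\<Sum>k<n. (if k = \<pi> i then d i else 0) * X $$ (k, j))"
      using that unfolding P_def by (simp add: scalar_prod_def atLeast0LessThan)
    also have "\<dots> = (\<Sum>k<n. if k = \<pi> i then d i * X $$ (\<pi> i, j) else 0)"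
      by (intro sum.cong refl) auto
    finally show ?thesis using \<pi>n[OF that(2)] by simp
  qed
  have "P * transpose_mat P = 1\<^sub>m n"
  proof (rule eq_matI)
    fix i j assume "i < dim_row (1\<^sub>m n :: real mat)" "j < dim_col (1\<^sub>m n :: real mat)"
    thus "(P * transpose_mat P) $$ (i, j) = 1\<^sub>m n $$ (i, j)"
      using PM[of "transpose_mat P" i j] P \<pi>n[of i] \<pi>inj d by (auto simp: P_def)
  qed (use P in auto)
  hence "transpose_mat P \<in> orthogonal_group n" using P by (intro orthogonal_groupI) auto
  thus "P \<in> orthogonal_group n" using transpose_orthogonal by fastforce
  show "P * M * transpose_mat P = mat n n (\<lambda>(i, j). d i * d j * M $$ (\<pi> i, \<pi> j))"
  proof (rule eq_matI)
    fix i j assume "i < dim_row (mat n n (\<lambda>(i, j). d i * d j * M $$ (\<pi> i, \<pi> j)))"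
      "j < dim_col (mat n n (\<lambda>(i, j). d i * d j * M $$ (\<pi> i, \<pi> j)))"
    hence ij: "i < n" "j < n" by auto
    have "(P * M * transpose_mat P) $$ (i, j) = (\<Sum>k<n. (P * M) $$ (i, k) * P $$ (j, k))"
      using P M ij by (simp add: scalar_prod_def atLeast0LessThan del: assoc_mult_mat)
    also have "\<dots> = (\<Sum>k<n. if k = \<pi> j then d i * d j * M $$ (\<pi> i, \<pi> j) else 0)"
      using ij by (intro sum.cong refl) (simp add: PM[OF M], auto simp: P_def)
    also have "\<dots> = d i * d j * M $$ (\<pi> i, \<pi> j)" using \<pi>n[OF ij(2)] by simp
    finally show "(P * M * transpose_mat P) $$ (i, j)
        = mat n n (\<lambda>(i, j). d i * d j * M $$ (\<pi> i, \<pi> j)) $$ (i, j)" using ij by simp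
  qed (use P M in auto)
qed

text \<open>The sign of one block is reversed by negating one of its two basis vectors. This conjugation has
determinant \<open>-1\<close>; for even \<open>n\<close> it is the reason to work with \<open>O(n)\<close> and not with \<open>SO(n)\<close>.\<close>

lemma skew_block_mat_flip:
  "\<exists>P\<in>orthogonal_group n. P * skew_block_mat n \<nu> * transpose_mat P = skew_block_mat n (\<nu>(a := - \<nu> a))"
proof -
  define d where "d i = (if i = 2 * a then - 1 else 1 :: real)" for i
  have half: "x div 2 = a \<longleftrightarrow> x = 2 * a" if "even x" for x using that by auto
  have "mat n n (\<lambda>(i, j). d i * d j * skew_block_mat n \<nu> $$ (id i, id j)) = skew_block_mat n (\<nu>(a := - \<nu> a))"
  proof (rule eq_matI)
    fix i j assume "i < dim_row (skew_block_mat n (\<nu>(a := - \<nu> a)))" "j < dim_col (skew_block_mat n (\<nu>(a := - \<nu> a)))"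
    hence ij: "i < n" "j < n" by (auto simp: skew_block_mat_def)
    consider "even i" "j = Suc i" | "even j" "i = Suc j" | "\<not> (even i \<and> j = Suc i)" "\<not> (odd i \<and> i = Suc j)"
      by fastforce
    thus "mat n n (\<lambda>(i, j). d i * d j * skew_block_mat n \<nu> $$ (id i, id j)) $$ (i, j)
        = skew_block_mat n (\<nu>(a := - \<nu> a)) $$ (i, j)"
    proof cases
      case 1
      hence "j \<noteq> 2 * a" by presburger
      thus ?thesis using 1 ij half[of i] by (simp add: skew_block_mat_def d_def)
    next
      case 2
      hence "i \<noteq> 2 * a" by presburger
      thus ?thesis using 2 ij half[of j] by (simp add: skew_block_mat_def d_def)
    next
      case 3
      thus ?thesis using ij unfolding skew_block_mat_def by auto
    qed
  qed (auto simp: skew_block_mat_def)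
  thus ?thesis
    using signed_permutation_conjugate[of id n d "skew_block_mat n \<nu>"] permutes_id[of "{..<n}"]
    by (simp add: d_def)
qed

text \<open>Permuting the blocks is conjugation by the permutation matrix that moves the index pairs
\<open>2t, 2t + 1\<close> along with \<open>t\<close>.\<close>

lemma skew_block_mat_permute:
  assumes \<sigma>: "\<sigma> permutes {..<n div 2}"
  shows "\<exists>P\<in>orthogonal_group n. P * skew_block_mat n \<nu> * transpose_mat P = skew_block_mat n (\<nu> \<circ> \<sigma>)"
proof -
  define \<pi> where "\<pi> i = (if i div 2 < n div 2 then 2 * \<sigma> (i div 2) + i mod 2 else i)" for i
  have \<sigma>k: "\<sigma> t < n div 2 \<longleftrightarrow> t < n div 2" for t using permutes_in_image[OF \<sigma>, of t] by simp
  have \<sigma>inj: "\<sigma> s = \<sigma> t \<longleftrightarrow> s = t" for s t using permutes_inj[OF \<sigma>] by (auto dest: injD)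
  have half: "\<pi> i div 2 = (if i div 2 < n div 2 then \<sigma> (i div 2) else i div 2)" "\<pi> i mod 2 = i mod 2" for i
    by (auto simp: \<pi>_def)
  have "inj_on \<pi> {..<n}"
  proof (rule inj_onI)
    fix i j assume "\<pi> i = \<pi> j"
    hence "i mod 2 = j mod 2" "\<pi> i div 2 = \<pi> j div 2" using half(2) by metis+
    moreover have "i div 2 = j div 2"
      using \<open>\<pi> i div 2 = \<pi> j div 2\<close> \<sigma>inj \<sigma>k unfolding half by (metis (full_types))
    ultimately show "i = j" by (metis div_mult_mod_eq)
  qed
  moreover have \<pi>n: "\<pi> i < n" if "i < n" for i
  proof (cases "i div 2 < n div 2")
    case True
    hence "\<sigma> (i div 2) < n div 2" using \<sigma>k by simp
    hence "2 * \<sigma> (i div 2) + i mod 2 < n" by presburger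
    thus ?thesis using True by (simp add: \<pi>_def)
  qed (use that in \<open>simp add: \<pi>_def\<close>)
  ultimately have "bij_betw \<pi> {..<n} {..<n}"
    by (metis bij_betw_def endo_inj_surj finite_lessThan image_subsetI lessThan_iff)
  moreover have "\<pi> i = i" if "i \<notin> {..<n}" for i
  proof (cases "i div 2 < n div 2")
    case True
    hence "i < n" by presburger
    thus ?thesis using that by simp
  qed (simp add: \<pi>_def)
  ultimately have \<pi>: "\<pi> permutes {..<n}" by (intro bij_imp_permutes) auto
  have succ: "y = Suc x \<longleftrightarrow> y div 2 = x div 2 \<and> y mod 2 = 1" if "even x" for x y :: nat
    using that by presburger
  have par: "even (\<pi> i) \<longleftrightarrow> even i" for i using half(2)[of i] by presburger
  have Suc_iff: "\<pi> j = Suc (\<pi> i) \<longleftrightarrow> j = Suc i" if "even i" "i < n" "j < n" for i j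
  proof -
    have "\<pi> j = Suc (\<pi> i) \<longleftrightarrow> \<pi> j div 2 = \<pi> i div 2 \<and> \<pi> j mod 2 = 1"
      using succ par that(1) by blast
    also have "\<dots> \<longleftrightarrow> j div 2 = i div 2 \<and> j mod 2 = 1"
      unfolding half using \<sigma>inj \<sigma>k by (metis (full_types))
    also have "\<dots> \<longleftrightarrow> j = Suc i" using succ[OF that(1)] by blast
    finally show ?thesis .
  qed
  have "mat n n (\<lambda>(i, j). 1 * 1 * skew_block_mat n \<nu> $$ (\<pi> i, \<pi> j)) = skew_block_mat n (\<nu> \<circ> \<sigma>)"
  proof (rule eq_matI)
    fix i j assume "i < dim_row (skew_block_mat n (\<nu> \<circ> \<sigma>))" "j < dim_col (skew_block_mat n (\<nu> \<circ> \<sigma>))"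
    hence ij: "i < n" "j < n" by (auto simp: skew_block_mat_def)
    have half_lt: "x div 2 < n div 2" if "even x" "Suc x < n" for x using that by presburger
    have "skew_block_mat n \<nu> $$ (\<pi> i, \<pi> j) = skew_block_mat n (\<nu> \<circ> \<sigma>) $$ (i, j)"
    proof (cases "even i")
      case True
      thus ?thesis using ij \<pi>n[OF ij(1)] \<pi>n[OF ij(2)] Suc_iff[OF True ij] par[of i] half(1)[of i] half_lt[of i]
        by (auto simp: skew_block_mat_def)
    next
      case False
      show ?thesis
      proof (cases "even j")
        case True
        thus ?thesis using False ij \<pi>n[OF ij(1)] \<pi>n[OF ij(2)] Suc_iff[OF True ij(2,1)] par[of i] half(1)[of j] half_lt[of j]
          by (auto simp: skew_block_mat_def)
      next
        case odd: False
        hence "i \<noteq> Suc j" "\<pi> i \<noteq> Suc (\<pi> j)" using False par[of i] par[of j] by auto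
        thus ?thesis using False ij \<pi>n[OF ij(1)] \<pi>n[OF ij(2)] par[of i] by (simp add: skew_block_mat_def)
      qed
    qed
    thus "mat n n (\<lambda>(i, j). 1 * 1 * skew_block_mat n \<nu> $$ (\<pi> i, \<pi> j)) $$ (i, j) = skew_block_mat n (\<nu> \<circ> \<sigma>) $$ (i, j)"
      using ij by simp
  qed (auto simp: skew_block_mat_def)
  thus ?thesis
    using signed_permutation_conjugate[OF \<pi>, of "\<lambda>_. 1" "skew_block_mat n \<nu>"] by simp
qed

lemma conjugate_mult:
  fixes X :: "'a :: comm_semiring_1 mat"
  assumes "g \<in> carrier_mat n n" "h \<in> carrier_mat n n" "X \<in> carrier_mat n n"
  shows "g * (h * X * transpose_mat h) * transpose_mat g = (g * h) * X * transpose_mat (g * h)"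
proof -
  have carr: "A * B \<in> carrier_mat n n" if "A \<in> carrier_mat n n" "B \<in> carrier_mat n n" for A B :: "'a mat"
    using that by simp
  show ?thesis
    using assms by (simp add: transpose_mult[of _ n n _ n] assoc_mult_mat[of _ n n _ n _ n] carr)
qed

text \<open>The characteristic polynomial identifies the block entries as the spectrum up to order, and the
order is corrected by a permutation of the blocks.\<close>

lemma skew_normal_form:
  assumes N: "N \<in> skew_mats n"
  obtains g where "g \<in> orthogonal_group n"
    "N = g * skew_block_mat n ((!) (skew_spectrum N)) * transpose_mat g"
proof -
  obtain g l where g: "g \<in> orthogonal_group n" and l: "length l = n div 2" "\<forall>x\<in>set l. 0 \<le> x"
    and gl: "transpose_mat g * N * g = skew_block_mat n ((!) l)"
    using skew_canonical_form[OF N] by blast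
  note gc = orthogonal_groupD[OF g] and Nc = skew_matsD(1)[OF N]
  have unconj: "X = h * (transpose_mat h * X * h) * transpose_mat h"
    if h: "h \<in> orthogonal_group n" and X: "X \<in> carrier_mat n n" for h X
  proof -
    note hc = orthogonal_groupD[OF h]
    have "h * (transpose_mat h * X * h) * transpose_mat h = (h * transpose_mat h) * X * (h * transpose_mat h)"
      using hc(1,2) X by (simp add: assoc_mult_mat[of _ n n _ n _ n])
    thus ?thesis using hc X by simp
  qed
  have Ng: "N = g * skew_block_mat n ((!) l) * transpose_mat g"
    using unconj[OF g Nc] unfolding gl .
  define l' where "l' = rev (sort l)"
  have m: "mset l' = mset l" by (simp add: l'_def)
  have "similar_mat N (skew_block_mat n ((!) l))"
    by (rule similar_matI[of _ _ g "transpose_mat g" n]) (use Nc gc Ng in auto)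
  hence "char_poly N = char_poly (skew_block_mat n ((!) l))" by (rule char_poly_similar)
  hence "char_poly (map_mat complex_of_real N) = char_poly (map_mat complex_of_real (skew_block_mat n ((!) l)))"
    by (simp add: of_real_hom.char_poly_hom[OF Nc] of_real_hom.char_poly_hom[OF skew_block_mat_carrier])
  moreover have entries: "map (\<lambda>t. h (l ! t)) [0..<n div 2] = map h l" for h :: "real \<Rightarrow> complex"
    using l(1) by (simp add: list_eq_iff_nth_eq)
  ultimately have "proots (char_poly (map_mat complex_of_real N))
     = mset (map (\<lambda>x. \<i> * complex_of_real x) l) + mset (map (\<lambda>x. - (\<i> * complex_of_real x)) l)
       + (if odd n then {#0#} else {#})"
    by (simp only: proots_skew_block_mat entries[of "\<lambda>x. \<i> * complex_of_real x"]
        entries[of "\<lambda>x. - (\<i> * complex_of_real x)"])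
  also have "mset (map h l) = mset (map h l')" for h :: "real \<Rightarrow> complex"
    using m by (simp only: mset_map)
  finally have "is_skew_spectrum N l'"
    unfolding is_skew_spectrum_def using Nc l by (auto simp: l'_def sorted_wrt_rev)
  hence sp: "skew_spectrum N = l'"
    using is_skew_spectrum_unique[OF is_skew_spectrum_skew_spectrum[OF N]] by simp
  obtain \<sigma> where \<sigma>: "\<sigma> permutes {..<length l}" "permute_list \<sigma> l = l'"
    using mset_eq_permutation[OF m] by blast
  obtain P where P: "P \<in> orthogonal_group n"
    "P * skew_block_mat n ((!) l) * transpose_mat P = skew_block_mat n ((!) l \<circ> \<sigma>)"
    using skew_block_mat_permute[of \<sigma> n "(!) l"] \<sigma>(1) l(1) by auto
  have Pl: "skew_block_mat n ((!) l \<circ> \<sigma>) = skew_block_mat n ((!) l')"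
    by (rule skew_block_mat_cong) (use \<sigma> l in \<open>auto simp: permute_list_nth\<close>)
  note Pc = orthogonal_groupD[OF P(1)]
  have "skew_block_mat n ((!) l) = transpose_mat P * skew_block_mat n ((!) l') * P"
    using unconj[OF transpose_orthogonal[OF P(1)] skew_block_mat_carrier, of "(!) l"] P(2) Pl
    by simp
  hence "N = g * (transpose_mat P * skew_block_mat n ((!) l') * P) * transpose_mat g" using Ng by simp
  also have "\<dots> = (g * transpose_mat P) * skew_block_mat n ((!) l') * transpose_mat (g * transpose_mat P)"
    using conjugate_mult[OF gc(1) Pc(2) skew_block_mat_carrier, of "(!) l'"] by simp
  finally show ?thesis
    using that[OF mult_orthogonal[OF g transpose_orthogonal[OF P(1)]]] sp by simp
qed

section \<open>Weak majorization\<close>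

text \<open>The argument of Hardy, Littlewood and Polya. As long as \<open>\<nu>\<close> differs from \<open>\<mu>\<close>, one more coordinate can be
made to agree without leaving \<open>D\<close> and without losing the prefix sum inequalities. If \<open>\<nu>\<close>
dominates \<open>\<mu>\<close>, an excessive coordinate is shrunk, by averaging with its sign change. Otherwise let \<open>b\<close> be the first
coordinate where \<open>\<nu>\<close> is too small; some earlier coordinate \<open>a\<close> is too large, and the amount \<open>\<delta>\<close> is
transferred from \<open>a\<close> to \<open>b\<close>, by averaging with the swap of the two. The prefix sums change only between
\<open>a\<close> and \<open>b\<close>, where the excess at \<open>a\<close> pays for it.\<close>

lemma weak_majorization_closure:
  fixes D :: "(nat \<Rightarrow> real) set" and \<mu> :: "nat \<Rightarrow> real"
  assumes convex: "\<And>\<nu> \<nu>' u. \<nu> \<in> D \<Longrightarrow> \<nu>' \<in> D \<Longrightarrow> 0 \<le> u \<Longrightarrow> u \<le> 1 \<Longrightarrow> (\<lambda>t. u * \<nu> t + (1 - u) * \<nu>' t) \<in> D"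
    and swap: "\<And>\<nu> a b. \<nu> \<in> D \<Longrightarrow> a < k \<Longrightarrow> b < k \<Longrightarrow> \<nu>(a := \<nu> b, b := \<nu> a) \<in> D"
    and flip: "\<And>\<nu> a. \<nu> \<in> D \<Longrightarrow> a < k \<Longrightarrow> \<nu>(a := - \<nu> a) \<in> D"
    and local: "\<And>\<nu> \<nu>'. \<nu> \<in> D \<Longrightarrow> (\<And>t. t < k \<Longrightarrow> \<nu> t = \<nu>' t) \<Longrightarrow> \<nu>' \<in> D"
    and dec: "\<And>s t. s \<le> t \<Longrightarrow> t < k \<Longrightarrow> \<mu> t \<le> \<mu> s"
    and nonneg: "\<And>t. t < k \<Longrightarrow> 0 \<le> \<mu> t"
    and \<nu>: "\<nu> \<in> D" and major: "\<And>j. j \<le> k \<Longrightarrow> (\<Sum>t<j. \<mu> t) \<le> (\<Sum>t<j. \<nu> t)"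
  shows "\<mu> \<in> D"
  using \<nu> major
proof (induction "card {t\<in>{..<k}. \<nu> t \<noteq> \<mu> t}" arbitrary: \<nu> rule: less_induct)
  case less
  let ?E = "\<lambda>\<nu>. {t\<in>{..<k}. \<nu> t \<noteq> \<mu> t}"
  have fin: "finite (?E \<nu>)" for \<nu> by simp
  consider (above) a where "a < k" "\<mu> a < \<nu> a" "\<And>t. t < k \<Longrightarrow> \<mu> t \<le> \<nu> t"
    | (below) b where "b < k" "\<nu> b < \<mu> b" "\<And>t. t < b \<Longrightarrow> \<mu> t \<le> \<nu> t"
    | (equal) "\<And>t. t < k \<Longrightarrow> \<nu> t = \<mu> t"
  proof (cases "\<exists>b<k. \<nu> b < \<mu> b")
    case True
    then obtain b where "b < k \<and> \<nu> b < \<mu> b" "\<And>t. t < b \<Longrightarrow> \<not> (t < k \<and> \<nu> t < \<mu> t)"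
      using exists_least_iff[of "\<lambda>b. b < k \<and> \<nu> b < \<mu> b"] by auto
    thus ?thesis using that(2)[of b] by force
  next
    case False
    thus ?thesis using that(1,3) by (metis linorder_not_le order_le_imp_less_or_eq)
  qed
  thus ?case
  proof cases
    case equal
    thus ?thesis using local[OF less.prems(1)] by blast
  next
    case above
    \<comment> \<open>The weight for which \<open>u * \<nu> a - (1 - u) * \<nu> a = \<mu> a\<close>.\<close>
    define u where "u = (1 + \<mu> a / \<nu> a) / 2"
    define \<nu>' where "\<nu>' = \<nu>(a := \<mu> a)"
    have pos: "0 < \<nu> a" "0 \<le> \<mu> a" using above nonneg[of a] by auto
    have u: "0 \<le> u" "u \<le> 1" using pos above(2) by (auto simp: u_def field_simps)
    have "(\<lambda>t. u * \<nu> t + (1 - u) * (\<nu>(a := - \<nu> a)) t) = \<nu>'"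
    proof
      fix t
      show "u * \<nu> t + (1 - u) * (\<nu>(a := - \<nu> a)) t = \<nu>' t"
        using pos by (cases "t = a") (auto simp: \<nu>'_def u_def field_simps)
    qed
    hence "\<nu>' \<in> D" using convex[OF less.prems(1) flip[OF less.prems(1) above(1)] u] by simp
    moreover have "(\<Sum>t<j. \<mu> t) \<le> (\<Sum>t<j. \<nu>' t)" if "j \<le> k" for j
      by (rule sum_mono) (use above that in \<open>auto simp: \<nu>'_def\<close>)
    moreover have "?E \<nu>' \<subset> ?E \<nu>"
    proof -
      have "a \<in> ?E \<nu>" "a \<notin> ?E \<nu>'" using above(1,2) by (simp_all add: \<nu>'_def)
      moreover have "?E \<nu>' \<subseteq> ?E \<nu>" by (auto simp: \<nu>'_def)
      ultimately show ?thesis by blast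
    qed
    hence "card (?E \<nu>') < card (?E \<nu>)" using fin by (rule psubset_card_mono[rotated])
    ultimately show ?thesis using less.hyps by blast
  next
    case below
    obtain a where a: "a < b" "\<mu> a < \<nu> a"
    proof -
      have "\<exists>a<b. \<mu> a < \<nu> a"
      proof (rule ccontr)
        assume "\<not> (\<exists>a<b. \<mu> a < \<nu> a)"
        hence "(\<Sum>t<b. \<nu> t) \<le> (\<Sum>t<b. \<mu> t)" by (intro sum_mono) (meson lessThan_iff not_le)
        hence "(\<Sum>t<Suc b. \<nu> t) < (\<Sum>t<Suc b. \<mu> t)" using below(2) by simp
        thus False using less.prems(2)[of "Suc b"] below(1) by simp
      qed
      thus ?thesis using that by blast
    qed
    define \<delta> where "\<delta> = min (\<nu> a - \<mu> a) (\<mu> b - \<nu> b)"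
    define \<nu>' where "\<nu>' = \<nu>(a := \<nu> a - \<delta>, b := \<nu> b + \<delta>)"
    \<comment> \<open>The weight for which averaging with the swap moves exactly \<open>\<delta>\<close>.\<close>
    define u where "u = 1 - \<delta> / (\<nu> a - \<nu> b)"
    have \<delta>: "0 < \<delta>" "\<delta> \<le> \<nu> a - \<mu> a" "\<delta> \<le> \<mu> b - \<nu> b" using a below by (auto simp: \<delta>_def)
    have \<mu>ab: "\<mu> b \<le> \<mu> a" using dec[of a b] a(1) below(1) by simp
    hence ab: "\<delta> \<le> \<nu> a - \<nu> b" "0 < \<nu> a - \<nu> b" using \<delta> by auto
    have u: "0 \<le> u" "u \<le> 1" using ab \<delta> by (auto simp: u_def)
    have \<delta>u: "(1 - u) * (\<nu> a - \<nu> b) = \<delta>" using ab by (simp add: u_def)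
    have "(\<lambda>t. u * \<nu> t + (1 - u) * (\<nu>(a := \<nu> b, b := \<nu> a)) t) = \<nu>'"
    proof
      fix t
      show "u * \<nu> t + (1 - u) * (\<nu>(a := \<nu> b, b := \<nu> a)) t = \<nu>' t"
        using \<delta>u a(1) unfolding \<nu>'_def by (auto simp: algebra_simps)
    qed
    hence "\<nu>' \<in> D"
      using convex[OF less.prems(1) swap[OF less.prems(1) _ below(1), of a] u] a(1) below(1) by simp
    moreover have "(\<Sum>t<j. \<mu> t) \<le> (\<Sum>t<j. \<nu>' t)" if j: "j \<le> k" for j
    proof -
      have "\<nu>' t = \<nu> t - (if t = a then \<delta> else 0) + (if t = b then \<delta> else 0)" for t
        using a(1) by (auto simp: \<nu>'_def)
      hence sum: "(\<Sum>t<j. \<nu>' t) = (\<Sum>t<j. \<nu> t) - (if a < j then \<delta> else 0) + (if b < j then \<delta> else 0)"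
        by (simp add: sum.distrib sum_subtractf)
      show ?thesis
      proof (cases "a < j \<and> j \<le> b")
        case True
        \<comment> \<open>All terms \<open>\<nu> t - \<mu> t\<close> before \<open>b\<close> are nonnegative, so their sum is at least the one at \<open>a\<close>.\<close>
        have "\<delta> \<le> \<nu> a - \<mu> a" by (rule \<delta>)
        also have "\<dots> \<le> (\<Sum>t<j. \<nu> t - \<mu> t)"
          by (rule member_le_sum[where f = "\<lambda>t. \<nu> t - \<mu> t"]) (use True below(3) in auto)
        finally show ?thesis using True sum by (simp add: sum_subtractf)
      next
        case False
        thus ?thesis using sum less.prems(2)[OF j] a(1) \<delta>(1) by auto
      qed
    qed
    moreover have "?E \<nu>' \<subset> ?E \<nu>"
    proof -
      have ab_in: "a \<in> ?E \<nu>" "b \<in> ?E \<nu>" using a below(1,2) by simp_all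
      moreover have "?E \<nu>' \<subseteq> ?E \<nu>"
      proof
        fix t assume t: "t \<in> ?E \<nu>'"
        show "t \<in> ?E \<nu>"
          using ab_in t by (cases "t = a"; cases "t = b") (simp_all add: \<nu>'_def)
      qed
      moreover have "a \<notin> ?E \<nu>' \<or> b \<notin> ?E \<nu>'" using a(1) by (auto simp: \<nu>'_def \<delta>_def min_def)
      ultimately show ?thesis by blast
    qed
    hence "card (?E \<nu>') < card (?E \<nu>)" using fin by (rule psubset_card_mono[rotated])
    ultimately show ?thesis using less.hyps by blast
  qed
qed

section \<open>The symmetric double of a skew-symmetric matrix\<close>

lemma skew_hat_carrier:
  assumes "A \<in> carrier_mat n n"
  shows "skew_hat A \<in> carrier_mat (2 * n) (2 * n)"
  using assms by (auto simp: skew_hat_def)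

lemma skew_hat_index:
  assumes "A \<in> skew_mats n" "i < 2 * n" "j < 2 * n"
  shows "skew_hat A $$ (i, j) =
    (if i < n then if j < n then 0 else A $$ (i, j - n)
     else if j < n then A $$ (j, i - n) else 0)"
proof -
  note A = skew_matsD[OF assms(1)]
  show ?thesis
    using assms(2,3) A(1) A(3)[of j "i - n"] by (auto simp: skew_hat_def)
qed

lemma skew_hat_symmetric:
  assumes A: "A \<in> skew_mats n"
  shows "transpose_mat (skew_hat A) = skew_hat A"
  using skew_hat_carrier[OF skew_matsD(1)[OF A]]
  by (intro eq_matI) (auto simp: skew_hat_index[OF A])

lemma sum_double:
  fixes n :: nat and h h' :: "nat \<Rightarrow> real"
  shows "(\<Sum>i<2 * n. if i < n then h i else h' (i - n)) = (\<Sum>i<n. h i) + (\<Sum>i<n. h' i)"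
proof -
  have "(\<Sum>i<2 * n. if i < n then h i else h' (i - n))
     = (\<Sum>i\<in>{0..<n}. if i < n then h i else h' (i - n)) + (\<Sum>i\<in>{n..<2 * n}. if i < n then h i else h' (i - n))"
    unfolding lessThan_atLeast0 by (rule sum.atLeastLessThan_concat[symmetric]) auto
  also have "(\<Sum>i\<in>{n..<2 * n}. if i < n then h i else h' (i - n)) = (\<Sum>i<n. h' i)"
    by (rule sum.reindex_bij_witness[where i = "\<lambda>i. i + n" and j = "\<lambda>i. i - n"]) auto
  finally show ?thesis by (simp add: lessThan_atLeast0)
qed

text \<open>The skew block matrix sends each basis vector to a signed multiple of the other one in its block.\<close>

definition block_partner :: "nat \<Rightarrow> nat" where
  "block_partner l = (if even l then Suc l else l - 1)"

definition block_sign :: "nat \<Rightarrow> real" where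
  "block_sign l = (if even l then 1 else - 1)"

lemma block_partner_lt: "l < 2 * k \<Longrightarrow> block_partner l < 2 * k"
  by (auto simp: block_partner_def)

lemma block_partner_inj: "block_partner l = block_partner l' \<longleftrightarrow> l = l'"
  unfolding block_partner_def by (cases "even l"; cases "even l'"; simp; presburger)

lemma skew_block_mat_index:
  assumes "i < n" "j < n"
  shows "skew_block_mat n \<nu> $$ (i, j) =
    (if i < 2 * (n div 2) \<and> j = block_partner i then block_sign i * \<nu> (i div 2) else 0)"
proof (cases "even i")
  case True
  have "i < 2 * (n div 2)" if "j = Suc i" using that True assms by presburger
  thus ?thesis using True assms by (auto simp: skew_block_mat_def block_partner_def block_sign_def)
next
  case False
  then obtain j' where j': "i = Suc j'" "even j'" by (auto elim!: oddE)
  have "i div 2 = j' div 2" "i < 2 * (n div 2)" using j' assms(1) by presburger+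
  thus ?thesis using j' assms by (auto simp: skew_block_mat_def block_partner_def block_sign_def)
qed

text \<open>The columns of \<open>g\<close> and their signed partners are the left and right singular vectors; each block
entry is a singular value twice, once for each index of its block.\<close>

lemma skew_singular_value_decomposition:
  assumes g: "g \<in> carrier_mat n n" and ij: "i < n" "j < n"
  shows "(g * skew_block_mat n \<nu> * transpose_mat g) $$ (i, j)
    = (\<Sum>l<2 * (n div 2). \<nu> (l div 2) * (g $$ (i, l) * (block_sign l * g $$ (j, block_partner l))))"
proof -
  let ?L = "2 * (n div 2)"
  have "(g * skew_block_mat n \<nu> * transpose_mat g) $$ (i, j)
     = (\<Sum>c<n. \<Sum>l<n. g $$ (i, l) * skew_block_mat n \<nu> $$ (l, c) * g $$ (j, c))"
    using g ij skew_block_mat_carrier[of n \<nu>]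
    by (simp add: scalar_prod_def atLeast0LessThan sum_distrib_right del: assoc_mult_mat skew_block_mat_carrier)
  also have "\<dots> = (\<Sum>l<n. \<Sum>c<n. g $$ (i, l) * skew_block_mat n \<nu> $$ (l, c) * g $$ (j, c))"
    by (rule sum.swap)
  also have "\<dots> = (\<Sum>l<n. if l < ?L then \<nu> (l div 2) * (g $$ (i, l) * (block_sign l * g $$ (j, block_partner l))) else 0)"
  proof (rule sum.cong[OF refl])
    fix l assume l: "l \<in> {..<n}"
    have "(\<Sum>c<n. g $$ (i, l) * skew_block_mat n \<nu> $$ (l, c) * g $$ (j, c))
       = (\<Sum>c<n. if c = block_partner l
            then if l < ?L then \<nu> (l div 2) * (g $$ (i, l) * (block_sign l * g $$ (j, block_partner l))) else 0 else 0)"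
      by (rule sum.cong[OF refl]) (use l in \<open>simp add: skew_block_mat_index\<close>)
    also have "\<dots> = (if l < ?L then \<nu> (l div 2) * (g $$ (i, l) * (block_sign l * g $$ (j, block_partner l))) else 0)"
      using block_partner_lt[of l "n div 2"] by (auto simp: sum.delta)
    finally show "(\<Sum>c<n. g $$ (i, l) * skew_block_mat n \<nu> $$ (l, c) * g $$ (j, c))
       = (if l < ?L then \<nu> (l div 2) * (g $$ (i, l) * (block_sign l * g $$ (j, block_partner l))) else 0)" .
  qed
  also have "\<dots> = (\<Sum>l<?L. \<nu> (l div 2) * (g $$ (i, l) * (block_sign l * g $$ (j, block_partner l))))"
    by (rule sum.mono_neutral_cong_right) auto
  finally show ?thesis .
qed

text \<open>Any decomposition \<open>A = \<Sum> b\<^sub>l z\<^sub>l z'\<^sub>l\<^sup>T\<close> into orthonormal singular vectors gives the eigenvectors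
\<open>(z\<^sub>l, z'\<^sub>l) / sqrt 2\<close> and \<open>(z\<^sub>l, - z'\<^sub>l) / sqrt 2\<close> of the symmetric matrix \<open>(0, A; A\<^sup>T, 0)\<close>, for the
eigenvalues \<open>b\<^sub>l\<close> and \<open>- b\<^sub>l\<close>. The parameter \<open>s\<close> chooses between the two.\<close>

definition doubled_column :: "nat \<Rightarrow> real mat \<Rightarrow> real \<Rightarrow> nat \<Rightarrow> nat \<Rightarrow> real" where
  "doubled_column n g s l i =
     (if i < n then g $$ (i, l) else s * block_sign l * g $$ (i - n, block_partner l)) / sqrt 2"

lemma doubled_column_inner:
  assumes g: "g \<in> orthogonal_group n" and l: "l < 2 * (n div 2)" "l' < 2 * (n div 2)"
  shows "(\<Sum>i<2 * n. doubled_column n g s l i * doubled_column n g s' l' i)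
    = (if l = l' then (1 + s * s') / 2 else 0)"
proof -
  note gc = orthogonal_groupD[OF g]
  have n: "l < n" "l' < n" "block_partner l < n" "block_partner l' < n"
    using l block_partner_lt[of l "n div 2"] block_partner_lt[of l' "n div 2"] by auto
  have col: "(\<Sum>i<n. g $$ (i, a) * g $$ (i, b)) = (if a = b then 1 else 0)" if "a < n" "b < n" for a b
  proof -
    have "(transpose_mat g * g) $$ (a, b) = (\<Sum>i<n. g $$ (i, a) * g $$ (i, b))"
      using gc(1) that by (simp add: scalar_prod_def atLeast0LessThan)
    thus ?thesis using gc(3) that by simp
  qed
  let ?c = "s * s' * (block_sign l * block_sign l')"
  have "(\<Sum>i<2 * n. doubled_column n g s l i * doubled_column n g s' l' i)
     = (\<Sum>i<2 * n. if i < n then g $$ (i, l) * g $$ (i, l') / 2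
          else (\<lambda>i. ?c * (g $$ (i, block_partner l) * g $$ (i, block_partner l')) / 2) (i - n))"
    by (intro sum.cong refl) (simp add: doubled_column_def)
  also have "\<dots> = (\<Sum>i<n. g $$ (i, l) * g $$ (i, l') / 2)
      + (\<Sum>i<n. ?c * (g $$ (i, block_partner l) * g $$ (i, block_partner l')) / 2)"
    by (rule sum_double)
  also have "\<dots> = (if l = l' then 1 else 0) / 2 + ?c * (if l = l' then 1 else 0) / 2"
    unfolding sum_divide_distrib[symmetric] sum_distrib_left[symmetric] col[OF n(1,2)] col[OF n(3,4)]
      block_partner_inj ..
  finally show ?thesis by (auto simp: block_sign_def add_divide_distrib)
qed

lemma skew_hat_spectral:
  assumes g: "g \<in> orthogonal_group n" and ij: "i < 2 * n" "j < 2 * n"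
  shows "skew_hat (g * skew_block_mat n \<nu> * transpose_mat g) $$ (i, j)
    = (\<Sum>l<2 * (n div 2). \<nu> (l div 2) *
        (doubled_column n g 1 l i * doubled_column n g 1 l j
         - doubled_column n g (-1) l i * doubled_column n g (-1) l j))"
proof -
  note gc = orthogonal_groupD[OF g]
  have skew: "g * skew_block_mat n \<nu> * transpose_mat g \<in> skew_mats n"
    by (rule skew_conjugate[OF skew_block_mat_skew gc(1)])
  show ?thesis
    unfolding skew_hat_index[OF skew ij]
    using ij skew_singular_value_decomposition[OF gc(1), of _ _ \<nu>]
    by (auto simp: doubled_column_def mult_ac intro!: sum.cong)
qed

text \<open>Each entry of the spectrum occurs twice among the eigenvalues of \<open>skew_hat\<close>, which is why compounds of
even order \<open>2j\<close> appear.\<close>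

lemma sum_pairs:
  fixes \<nu> :: "nat \<Rightarrow> real"
  shows "(\<Sum>l<2 * j. \<nu> (l div 2)) = 2 * (\<Sum>t<j. \<nu> t)"
  by (induction j) auto

lemma skew_hat_form_le:
  assumes g: "g \<in> orthogonal_group n"
    and dec: "\<And>s t. s \<le> t \<Longrightarrow> t < n div 2 \<Longrightarrow> \<nu> t \<le> \<nu> s" and nonneg: "\<And>t. t < n div 2 \<Longrightarrow> 0 \<le> \<nu> t"
    and j: "1 \<le> j" "j \<le> n div 2" and f: "f \<in> fock_space (2 * n) (2 * j)"
  shows "second_quantized_form (2 * n) (\<lambda>i j. skew_hat (g * skew_block_mat n \<nu> * transpose_mat g) $$ (i, j)) f
    \<le> 2 * (\<Sum>t<j. \<nu> t) * fock_sqnorm (2 * n) f"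
  unfolding sum_pairs[symmetric]
proof (rule second_quantized_form_le[where L = "2 * (n div 2)" and e = "doubled_column n g 1"
      and e' = "doubled_column n g (-1)"])
  show "orthonormal_family (2 * n) (2 * (n div 2)) (doubled_column n g 1)"
    unfolding orthonormal_family_def using doubled_column_inner[OF g] by simp
  show "\<nu> (l' div 2) \<le> \<nu> (l div 2)" if "l \<le> l'" "l' < 2 * (n div 2)" for l l'
    by (rule dec) (use that in \<open>auto simp: div_le_mono\<close>)
  show "0 \<le> \<nu> (l div 2)" if "l < 2 * (n div 2)" for l
    by (rule nonneg) (use that in auto)
qed (use skew_hat_spectral[OF g] j f in auto)

lemma skew_hat_form_attained:
  assumes g: "g \<in> orthogonal_group n" and j: "j \<le> n div 2"
  obtains f where "f \<in> fock_space (2 * n) (2 * j)" "fock_sqnorm (2 * n) f = 1"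
    "second_quantized_form (2 * n) (\<lambda>i j. skew_hat (g * skew_block_mat n \<nu> * transpose_mat g) $$ (i, j)) f
      = 2 * (\<Sum>t<j. \<nu> t)"
proof
  let ?f = "slater (2 * n) (doubled_column n g 1) (2 * j)"
  have orth: "orthonormal_family (2 * n) (2 * (n div 2)) (doubled_column n g 1)"
    unfolding orthonormal_family_def using doubled_column_inner[OF g] by simp
  have j2: "2 * j \<le> 2 * (n div 2)" using j by simp
  show "?f \<in> fock_space (2 * n) (2 * j)" by (rule slater_in_fock_space)
  show "fock_sqnorm (2 * n) ?f = 1" by (rule sqnorm_slater[OF orth j2])
  show "second_quantized_form (2 * n) (\<lambda>i j. skew_hat (g * skew_block_mat n \<nu> * transpose_mat g) $$ (i, j)) ?f
      = 2 * (\<Sum>t<j. \<nu> t)"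
    unfolding sum_pairs[symmetric]
  proof (rule second_quantized_form_slater[OF _ orth _ j2, where e' = "doubled_column n g (-1)"])
    show "(\<Sum>i<2 * n. doubled_column n g (-1) l i * doubled_column n g 1 l' i) = 0"
      if "l < 2 * (n div 2)" "l' < 2 * (n div 2)" for l l'
      using doubled_column_inner[OF g that, of "-1" 1] by simp
  qed (use skew_hat_spectral[OF g] in auto)
qed

section \<open>The orbitope\<close>

lemma orbit_subset_skew_orbitope:
  "g \<in> orthogonal_group n \<Longrightarrow> g * N * transpose_mat g \<in> skew_orbitope n N"
  unfolding skew_orbitope_def by (rule subsetD[OF hull_subset]) blast

lemma skew_orbitope_minimal:
  assumes "mat_convex S" "\<And>g. g \<in> orthogonal_group n \<Longrightarrow> g * N * transpose_mat g \<in> S"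
  shows "skew_orbitope n N \<subseteq> S"
  unfolding skew_orbitope_def by (rule hull_minimal) (use assms in auto)

lemma mat_convex_skew_orbitope: "mat_convex (skew_orbitope n N)"
  unfolding skew_orbitope_def by (rule hull_in) (auto simp: mat_convex_def)

lemma skew_orbitope_convex_combination:
  assumes "X \<in> skew_orbitope n N" "Y \<in> skew_orbitope n N" "0 \<le> u" "0 \<le> v" "u + v = 1"
  shows "u \<cdot>\<^sub>m X + v \<cdot>\<^sub>m Y \<in> skew_orbitope n N"
  using mat_convex_skew_orbitope assms unfolding mat_convex_def by blast

text \<open>The matrices whose conjugate by \<open>h\<close> lies in the orbitope form a convex set that contains the orbit.\<close>

lemma skew_orbitope_conjugate:
  assumes N: "N \<in> skew_mats n" and h: "h \<in> orthogonal_group n" and X: "X \<in> skew_orbitope n N"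
  shows "h * X * transpose_mat h \<in> skew_orbitope n N"
proof -
  note hc = orthogonal_groupD[OF h] and Nc = skew_matsD(1)[OF N]
  let ?S = "{X \<in> carrier_mat n n. h * X * transpose_mat h \<in> skew_orbitope n N}"
  have "skew_orbitope n N \<subseteq> ?S"
  proof (rule skew_orbitope_minimal)
    show "mat_convex ?S"
      unfolding mat_convex_def
    proof (intro ballI allI impI)
      fix X Y u v assume X: "X \<in> ?S" and Y: "Y \<in> ?S" and uv: "0 \<le> (u::real)" "0 \<le> (v::real)" "u + v = 1"
      have c: "X \<in> carrier_mat n n" "Y \<in> carrier_mat n n" using X Y by auto
      have "h * (u \<cdot>\<^sub>m X + v \<cdot>\<^sub>m Y) * transpose_mat h
         = (u \<cdot>\<^sub>m (h * X) + v \<cdot>\<^sub>m (h * Y)) * transpose_mat h"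
        using c hc(1) by (simp add: mult_add_distrib_mat[of _ n n _ n] mult_smult_distrib[of _ n n _ n])
      also have "\<dots> = u \<cdot>\<^sub>m (h * X * transpose_mat h) + v \<cdot>\<^sub>m (h * Y * transpose_mat h)"
        using c hc(1,2) mult_carrier_mat[OF hc(1) c(1)] mult_carrier_mat[OF hc(1) c(2)]
        by (simp add: add_mult_distrib_mat[of _ n n _ _ n] mult_smult_assoc_mat[of _ n n _ n] del: assoc_mult_mat)
      also have "\<dots> \<in> skew_orbitope n N"
        using X Y uv by (intro skew_orbitope_convex_combination) auto
      finally show "u \<cdot>\<^sub>m X + v \<cdot>\<^sub>m Y \<in> ?S" using c by simp
    qed
    fix g assume g: "g \<in> orthogonal_group n"
    note gc = orthogonal_groupD[OF g]
    have "h * (g * N * transpose_mat g) * transpose_mat h \<in> skew_orbitope n N"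
      unfolding conjugate_mult[OF hc(1) gc(1) Nc]
      by (rule orbit_subset_skew_orbitope[OF mult_orthogonal[OF h g]])
    moreover have "g * N * transpose_mat g \<in> carrier_mat n n" using gc(1) Nc by simp
    ultimately show "g * N * transpose_mat g \<in> ?S" by simp
  qed
  thus ?thesis using X by blast
qed

lemma skew_block_mat_convex_combination:
  "skew_block_mat n (\<lambda>t. u * \<nu> t + v * \<nu>' t) = u \<cdot>\<^sub>m skew_block_mat n \<nu> + v \<cdot>\<^sub>m skew_block_mat n \<nu>'"
  by (rule eq_matI) (auto simp: skew_block_mat_def)

lemma swap_permutes:
  assumes "a < k" "b < k"
  shows "id(a := b, b := a) permutes {..<k::nat}"
proof (rule bij_imp_permutes)
  show "bij_betw (id(a := b, b := a)) {..<k} {..<k}"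
    by (rule bij_betw_byWitness[where f' = "id(a := b, b := a)"]) (use assms in auto)
qed (use assms in auto)

lemma skew_spectrum_nonneg_decreasing:
  assumes "N \<in> skew_mats n"
  shows "\<And>s t. s \<le> t \<Longrightarrow> t < n div 2 \<Longrightarrow> skew_spectrum N ! t \<le> skew_spectrum N ! s"
    and "\<And>t. t < n div 2 \<Longrightarrow> 0 \<le> skew_spectrum N ! t"
proof -
  let ?l = "skew_spectrum N"
  have l: "length ?l = n div 2" "sorted_wrt (\<ge>) ?l" "\<forall>x\<in>set ?l. 0 \<le> x"
    using is_skew_spectrum_skew_spectrum[OF assms] skew_matsD(1)[OF assms]
    by (auto simp: is_skew_spectrum_def)
  show "?l ! t \<le> ?l ! s" if "s \<le> t" "t < n div 2" for s t
    using sorted_wrt_nth_less[OF l(2), of s t] that l(1) by (cases "s = t") auto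
  show "0 \<le> ?l ! t" if "t < n div 2" for t using that l by simp
qed

theorem theorem3p15:
  fixes N :: "real mat" and n k :: nat
  assumes "N \<in> skew_mats n"
    and "k = n div 2"
  shows "skew_orbitope n N =
    {A \<in> skew_mats n. \<forall>j\<in>{1..k}.
       psd_mat ((2 * (\<Sum>i<j. skew_spectrum N ! i)) \<cdot>\<^sub>m 1\<^sub>m ((2 * n) choose (2 * j))
                - additive_compound (2 * j) (skew_hat A))}"
proof -
  let ?spec = "(!) (skew_spectrum N)"
  let ?Q = "\<lambda>A. second_quantized_form (2 * n) (\<lambda>i j. skew_hat A $$ (i, j))"
  define R where "R = {A \<in> skew_mats n. \<forall>j\<in>{1..k}. \<forall>f\<in>fock_space (2 * n) (2 * j).
      ?Q A f \<le> 2 * (\<Sum>i<j. ?spec i) * fock_sqnorm (2 * n) f}"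
  have R_eq: "{A \<in> skew_mats n. \<forall>j\<in>{1..k}.
       psd_mat ((2 * (\<Sum>i<j. ?spec i)) \<cdot>\<^sub>m 1\<^sub>m ((2 * n) choose (2 * j))
                - additive_compound (2 * j) (skew_hat A))} = R"
    unfolding R_def
    using psd_additive_compound_iff[OF skew_hat_carrier[OF skew_matsD(1)] skew_hat_symmetric]
    by blast
  note spec = skew_spectrum_nonneg_decreasing[OF assms(1)]
  obtain h where h: "h \<in> orthogonal_group n" and N: "N = h * skew_block_mat n ?spec * transpose_mat h"
    by (rule skew_normal_form[OF assms(1)])
  note hc = orthogonal_groupD[OF h]
  have "skew_orbitope n N \<subseteq> R"
  proof (rule skew_orbitope_minimal)
    show "mat_convex R"
      unfolding mat_convex_def
    proof (intro ballI allI impI)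
      fix X Y u v assume X: "X \<in> R" and Y: "Y \<in> R" and uv: "0 \<le> (u::real)" "0 \<le> (v::real)" "u + v = 1"
      let ?Z = "u \<cdot>\<^sub>m X + v \<cdot>\<^sub>m Y"
      have skew: "X \<in> skew_mats n" "Y \<in> skew_mats n" using X Y by (auto simp: R_def)
      note Xs = skew_matsD[OF skew(1)] and Ys = skew_matsD[OF skew(2)]
      have Z: "?Z \<in> skew_mats n"
      proof (rule skew_matsI)
        fix i j assume ij: "i < n" "j < n"
        show "?Z $$ (i, j) = - ?Z $$ (j, i)"
          using ij Xs(1) Ys(1) Xs(3)[OF ij] Ys(3)[OF ij] by simp
      qed (use Xs(1) Ys(1) in auto)
      have hat: "skew_hat ?Z $$ (i, j) = u * skew_hat X $$ (i, j) + v * skew_hat Y $$ (i, j)"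
        if "i < 2 * n" "j < 2 * n" for i j
        using that Xs(1) Ys(1)
        by (simp add: skew_hat_index[OF Z] skew_hat_index[OF skew(1)] skew_hat_index[OF skew(2)])
      have Q: "?Q ?Z f = u * ?Q X f + v * ?Q Y f" for f
        unfolding second_quantized_form_def sum_distrib_left sum.distrib[symmetric]
        by (intro sum.cong refl) (simp add: hat algebra_simps)
      have "?Q ?Z f \<le> c * F" if "?Q X f \<le> c * F" "?Q Y f \<le> c * F" for f c F
      proof -
        have "?Q ?Z f \<le> u * (c * F) + v * (c * F)"
          unfolding Q using that uv by (intro add_mono mult_left_mono) auto
        also have "\<dots> = (u + v) * (c * F)" by (simp add: algebra_simps)
        finally show ?thesis using uv by simp
      qed
      thus "?Z \<in> R" using X Y Z unfolding R_def by blast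
    qed
    fix g assume g: "g \<in> orthogonal_group n"
    have gN: "g * N * transpose_mat g = (g * h) * skew_block_mat n ?spec * transpose_mat (g * h)"
      by (subst N) (rule conjugate_mult[OF orthogonal_groupD(1)[OF g] hc(1) skew_block_mat_carrier])
    have gh: "g * h \<in> orthogonal_group n" by (rule mult_orthogonal[OF g h])
    show "g * N * transpose_mat g \<in> R"
      unfolding R_def
    proof (intro CollectI conjI ballI)
      show "g * N * transpose_mat g \<in> skew_mats n"
        by (rule skew_conjugate[OF assms(1) orthogonal_groupD(1)[OF g]])
      fix j f assume "j \<in> {1..k}" "f \<in> fock_space (2 * n) (2 * j)"
      thus "?Q (g * N * transpose_mat g) f \<le> 2 * (\<Sum>i<j. ?spec i) * fock_sqnorm (2 * n) f"
        unfolding gN using assms(2) by (intro skew_hat_form_le[OF gh spec]) auto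
    qed
  qed
  moreover have "R \<subseteq> skew_orbitope n N"
  proof
    fix A assume A: "A \<in> R"
    hence skew: "A \<in> skew_mats n" by (simp add: R_def)
    let ?\<mu> = "(!) (skew_spectrum A)"
    note \<mu> = skew_spectrum_nonneg_decreasing[OF skew]
    obtain g where g: "g \<in> orthogonal_group n" and Ag: "A = g * skew_block_mat n ?\<mu> * transpose_mat g"
      by (rule skew_normal_form[OF skew])
    \<comment> \<open>Conjugation by \<open>O(n)\<close> makes \<open>D\<close> invariant under the signed permutations of the first \<open>k\<close> coordinates.\<close>
    define D where "D = {\<nu>. skew_block_mat n \<nu> \<in> skew_orbitope n N}"
    have D_conj: "\<nu>' \<in> D" if "\<nu> \<in> D"
      "\<exists>P\<in>orthogonal_group n. P * skew_block_mat n \<nu> * transpose_mat P = skew_block_mat n \<nu>'" for \<nu> \<nu>'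
      using that skew_orbitope_conjugate[OF assms(1)] unfolding D_def by (metis mem_Collect_eq)
    have "?\<mu> \<in> D"
    proof (rule weak_majorization_closure[where k = k and \<nu> = ?spec])
      fix \<nu> \<nu>' u assume "\<nu> \<in> D" "\<nu>' \<in> D" "0 \<le> (u::real)" "u \<le> 1"
      thus "(\<lambda>t. u * \<nu> t + (1 - u) * \<nu>' t) \<in> D"
        unfolding D_def by (auto simp: skew_block_mat_convex_combination intro!: skew_orbitope_convex_combination)
    next
      fix \<nu> :: "nat \<Rightarrow> real" and a b assume "\<nu> \<in> D" "a < k" "b < k"
      moreover have "\<nu> \<circ> id(a := b, b := a) = \<nu>(a := \<nu> b, b := \<nu> a)" by auto
      ultimately show "\<nu>(a := \<nu> b, b := \<nu> a) \<in> D"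
        using D_conj skew_block_mat_permute[of "id(a := b, b := a)" n \<nu>] swap_permutes[of a k b] assms(2)
        by metis
    next
      fix \<nu> :: "nat \<Rightarrow> real" and a assume "\<nu> \<in> D"
      thus "\<nu>(a := - \<nu> a) \<in> D" using D_conj skew_block_mat_flip by blast
    next
      fix \<nu> \<nu>' :: "nat \<Rightarrow> real" assume "\<nu> \<in> D" "\<And>t. t < k \<Longrightarrow> \<nu> t = \<nu>' t"
      thus "\<nu>' \<in> D" using skew_block_mat_cong[of n \<nu> \<nu>'] assms(2) unfolding D_def by simp
    next
      have "transpose_mat h * N * transpose_mat (transpose_mat h)
         = (transpose_mat h * h) * skew_block_mat n ?spec * transpose_mat (transpose_mat h * h)"
        by (subst N) (rule conjugate_mult[OF hc(2,1) skew_block_mat_carrier])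
      also have "\<dots> = skew_block_mat n ?spec"
        by (simp add: hc(3) left_mult_one_mat[OF skew_block_mat_carrier] right_mult_one_mat[OF skew_block_mat_carrier])
      finally have "skew_block_mat n ?spec = transpose_mat h * N * transpose_mat (transpose_mat h)" ..
      thus "?spec \<in> D"
        using orbit_subset_skew_orbitope[OF transpose_orthogonal[OF h], of N]
        unfolding D_def by (simp only: mem_Collect_eq)
    next
      fix j assume j: "j \<le> k"
      show "(\<Sum>t<j. ?\<mu> t) \<le> (\<Sum>t<j. ?spec t)"
      proof (cases "j = 0")
        case False
        obtain f where f: "f \<in> fock_space (2 * n) (2 * j)" "fock_sqnorm (2 * n) f = 1"
          "?Q A f = 2 * (\<Sum>t<j. ?\<mu> t)"
          using skew_hat_form_attained[OF g, of j ?\<mu>] j assms(2) Ag by metis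
        have "?Q A f \<le> 2 * (\<Sum>i<j. ?spec i) * fock_sqnorm (2 * n) f"
          using A f(1) j False unfolding R_def by auto
        thus ?thesis using f by simp
      qed simp
    qed (use \<mu> assms(2) in auto)
    hence "g * skew_block_mat n ?\<mu> * transpose_mat g \<in> skew_orbitope n N"
      using skew_orbitope_conjugate[OF assms(1) g] by (simp add: D_def)
    thus "A \<in> skew_orbitope n N" using Ag by simp
  qed
  ultimately show ?thesis unfolding R_eq by blast
qed

end
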